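(* For each prime $p$, there exists a rank-one torsion-free atomic monoid $M$ such that the monoid algebra $\mathbb{F}_p[M]$ is not quasi-atomic.
   Context: Monoids are cancellative and commutative, with identity. The rank of a monoid is the rank of its Grothendieck group as a $\mathbb{Z}$-module; a monoid is torsion-free if its Grothendieck group is torsion-free. In a monoid $H$, an atom is a non-invertible element that is not a product (sum, in additive notation) of two non-invertible elements; an element is atomic if it is invertible or a product of finitely many atoms. $H$ is atomic if all its elements are atomic, and quasi-atomic if for each $b\in H$ there is $a\in H$ such that $ab$ is atomic. An integral domain is quasi-atomic if its multiplicative monoid of nonzero elements is quasi-atomic. $\mathbb{F}_p$ is the field with $p$ elements, and, for an additively written torsion-free monoid $M$, $\mathbb{F}_p[M]$ is the monoid algebra of all polynomial expressions $\sum_i c_i x^{q_i}$ (finite sums) with $c_i\in\mathbb{F}_p$ and $q_i\in M$; it is an integral domain. *)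

theory Defs
  imports
    "HOL-Number_Theory.Residues"
    "HOL-Algebra.Divisibility"
    "HOL-Library.Extended_Nat"
begin

text \<open>
  Monoids are the records of HOL-Algebra, always used under the locale predicate
  \<^locale>\<open>comm_monoid_cancel\<close>. The operation of such a record is written multiplicatively
  whatever its origin; for an additively written monoid, read sums for products, and multiples
  for powers.
\<close>

section \<open>Atoms, atomic and quasi-atomic monoids\<close>

definition atom :: "('a, 'c) monoid_scheme \<Rightarrow> 'a \<Rightarrow> bool"
  where "atom H a \<longleftrightarrow> a \<in> carrier H \<and> a \<notin> Units H \<and>
    \<not> (\<exists>b \<in> carrier H - Units H. \<exists>c \<in> carrier H - Units H. a = b \<otimes>\<^bsub>H\<^esub> c)"

lemma (in comm_monoid_cancel) atom_iff_irreducible: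
  "atom G a \<longleftrightarrow> a \<in> carrier G \<and> irreducible G a"
proof (intro iffI conjI)
  assume a: "atom G a"
  then show aG: "a \<in> carrier G" by (simp add: atom_def)
  show "irreducible G a"
    unfolding irreducible_def
  proof (intro conjI ballI impI)
    show "a \<notin> Units G" using a by (simp add: atom_def)
    fix b assume b: "b \<in> carrier G" and pf: "properfactor G b a"
    then obtain c where c: "c \<in> carrier G" "a = b \<otimes> c"
      by (auto simp: properfactor_def factor_def)
    show "b \<in> Units G"
    proof (rule ccontr)
      assume "b \<notin> Units G"
      with a b c have "c \<in> Units G" by (auto simp: atom_def)
      then have "b = a \<otimes> inv c" using b c by (simp add: m_assoc)
      then have "a divides b" using \<open>c \<in> Units G\<close> by (auto simp: factor_def)
      with pf show False by (simp add: properfactor_def)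
    qed
  qed
next
  assume a: "a \<in> carrier G \<and> irreducible G a"
  show "atom G a"
    unfolding atom_def
  proof (intro conjI notI)
    show "a \<in> carrier G" using a by simp
    show False if "a \<in> Units G" using a that by (simp add: irreducible_def)
    assume "\<exists>b \<in> carrier G - Units G. \<exists>c \<in> carrier G - Units G. a = b \<otimes> c"
    then obtain b c where bc: "b \<in> carrier G" "b \<notin> Units G" "c \<in> carrier G" "c \<notin> Units G"
      "a = b \<otimes> c" by auto
    with a have "a divides b" by (auto simp: irreducible_def properfactor_def factor_def)
    then obtain d where d: "d \<in> carrier G" "b = (b \<otimes> c) \<otimes> d" using bc by (auto simp: factor_def)
    then have "b \<otimes> (c \<otimes> d) = b \<otimes> \<one>" using bc by (simp add: m_assoc)
    then have "c \<otimes> d = \<one>" using bc d l_cancel by blast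
    then show False using bc d by (metis Units_one_closed unit_factor)
  qed
qed

definition atomic_element :: "('a, 'c) monoid_scheme \<Rightarrow> 'a \<Rightarrow> bool"
  where "atomic_element H a \<longleftrightarrow> a \<in> Units H \<or>
    (\<exists>as. as \<noteq> [] \<and> (\<forall>x \<in> set as. atom H x) \<and> foldr (\<otimes>\<^bsub>H\<^esub>) as \<one>\<^bsub>H\<^esub> = a)"

definition atomic_monoid :: "('a, 'c) monoid_scheme \<Rightarrow> bool"
  where "atomic_monoid H \<longleftrightarrow> (\<forall>a \<in> carrier H. atomic_element H a)"

definition quasi_atomic_monoid :: "('a, 'c) monoid_scheme \<Rightarrow> bool"
  where "quasi_atomic_monoid H \<longleftrightarrow>
    (\<forall>b \<in> carrier H. \<exists>a \<in> carrier H. atomic_element H (a \<otimes>\<^bsub>H\<^esub> b))"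

text \<open>
  Meant for integral domains only; \<^term>\<open>mult_of R\<close> is the multiplicative monoid of the nonzero
  elements of \<^term>\<open>R\<close>.
\<close>

definition quasi_atomic_domain :: "('a, 'c) ring_scheme \<Rightarrow> bool"
  where "quasi_atomic_domain R \<longleftrightarrow> quasi_atomic_monoid (mult_of R)"

section \<open>Grothendieck group, rank, torsion-freeness\<close>

text \<open>
  The class of \<open>(a, b)\<close> is the formal quotient \<open>a / b\<close>. For cancellative monoids the usual extra
  factor in the relation (\<open>a \<otimes> d \<otimes> k = b \<otimes> c \<otimes> k\<close> for some \<open>k\<close>) is not needed.
\<close>

definition groth_rel :: "('a, 'c) monoid_scheme \<Rightarrow> (('a \<times> 'a) \<times> ('a \<times> 'a)) set"
  where "groth_rel M = {((a, b), (c, d)) | a b c d.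
    a \<in> carrier M \<and> b \<in> carrier M \<and> c \<in> carrier M \<and> d \<in> carrier M \<and>
    a \<otimes>\<^bsub>M\<^esub> d = b \<otimes>\<^bsub>M\<^esub> c}"

definition grothendieck_group :: "('a, 'c) monoid_scheme \<Rightarrow> ('a \<times> 'a) set monoid"
  where "grothendieck_group M =
    \<lparr>carrier = (carrier M \<times> carrier M) // groth_rel M,
     monoid.mult = (\<lambda>X Y. \<Union>(a, b) \<in> X. \<Union>(c, d) \<in> Y. groth_rel M `` {(a \<otimes>\<^bsub>M\<^esub> c, b \<otimes>\<^bsub>M\<^esub> d)}),
     one = groth_rel M `` {(\<one>\<^bsub>M\<^esub>, \<one>\<^bsub>M\<^esub>)}\<rparr>"

lemma (in comm_monoid_cancel) equiv_groth_rel: "equiv (carrier G \<times> carrier G) (groth_rel G)"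
proof (rule equivI)
  show "groth_rel G \<subseteq> (carrier G \<times> carrier G) \<times> (carrier G \<times> carrier G)"
    by (auto simp: groth_rel_def)
  show "refl_on (carrier G \<times> carrier G) (groth_rel G)"
    by (auto simp: refl_on_def groth_rel_def m_comm)
  show "sym (groth_rel G)"
    by (auto simp: sym_def groth_rel_def m_comm)
  show "trans (groth_rel G)"
  proof (rule transI)
    fix x y z assume "(x, y) \<in> groth_rel G" "(y, z) \<in> groth_rel G"
    then obtain a b c d e f where xyz: "x = (a, b)" "y = (c, d)" "z = (e, f)"
      and [simp]: "a \<in> carrier G" "b \<in> carrier G" "c \<in> carrier G" "d \<in> carrier G"
        "e \<in> carrier G" "f \<in> carrier G"
      and eq: "a \<otimes> d = b \<otimes> c" "c \<otimes> f = d \<otimes> e"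
      by (auto simp: groth_rel_def)
    have "d \<otimes> (a \<otimes> f) = (a \<otimes> d) \<otimes> f" by (simp add: m_ac)
    also have "\<dots> = b \<otimes> (c \<otimes> f)" by (simp add: eq(1) m_assoc)
    also have "\<dots> = d \<otimes> (b \<otimes> e)" by (simp add: eq(2) m_lcomm)
    finally have "a \<otimes> f = b \<otimes> e" by (rule l_cancel) auto
    then show "(x, z) \<in> groth_rel G" by (auto simp: xyz groth_rel_def)
  qed
qed

lemma (in comm_monoid_cancel) groth_mult_class:
  assumes [simp]: "a \<in> carrier G" "b \<in> carrier G" "c \<in> carrier G" "d \<in> carrier G"
  shows "groth_rel G `` {(a, b)} \<otimes>\<^bsub>grothendieck_group G\<^esub> groth_rel G `` {(c, d)} =
    groth_rel G `` {(a \<otimes> c, b \<otimes> d)}"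
proof -
  have cong: "groth_rel G `` {(a' \<otimes> c', b' \<otimes> d')} = groth_rel G `` {(a \<otimes> c, b \<otimes> d)}"
    if "((a, b), (a', b')) \<in> groth_rel G" "((c, d), (c', d')) \<in> groth_rel G" for a' b' c' d'
  proof -
    have [simp]: "a' \<in> carrier G" "b' \<in> carrier G" "c' \<in> carrier G" "d' \<in> carrier G"
      and eq: "a \<otimes> b' = b \<otimes> a'" "c \<otimes> d' = d \<otimes> c'"
      using that by (auto simp: groth_rel_def)
    have "(a \<otimes> c) \<otimes> (b' \<otimes> d') = (a \<otimes> b') \<otimes> (c \<otimes> d')" by (simp add: m_ac)
    also have "\<dots> = (b \<otimes> d) \<otimes> (a' \<otimes> c')" by (simp add: eq m_ac)
    finally have "((a \<otimes> c, b \<otimes> d), (a' \<otimes> c', b' \<otimes> d')) \<in> groth_rel G"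
      by (auto simp: groth_rel_def)
    then show ?thesis by (metis equiv_class_eq[OF equiv_groth_rel])
  qed
  have self: "((a, b), (a, b)) \<in> groth_rel G" "((c, d), (c, d)) \<in> groth_rel G"
    by (auto simp: groth_rel_def m_comm)
  show ?thesis
    unfolding grothendieck_group_def using self cong by fastforce
qed

lemma (in comm_monoid_cancel) grothendieck_group_cases:
  assumes "X \<in> carrier (grothendieck_group G)"
  obtains a b where "a \<in> carrier G" "b \<in> carrier G" "X = groth_rel G `` {(a, b)}"
  using assms by (auto simp: grothendieck_group_def elim!: quotientE)

lemma (in comm_monoid_cancel) groth_class_closed:
  "a \<in> carrier G \<Longrightarrow> b \<in> carrier G \<Longrightarrow> groth_rel G `` {(a, b)} \<in> carrier (grothendieck_group G)"
  by (auto simp: grothendieck_group_def intro: quotientI)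

lemma (in comm_monoid_cancel) comm_group_grothendieck_group: "comm_group (grothendieck_group G)"
proof -
  let ?K = "grothendieck_group G"
  have one: "\<one>\<^bsub>?K\<^esub> = groth_rel G `` {(\<one>, \<one>)}" by (simp add: grothendieck_group_def)
  note cl = groth_class_closed groth_mult_class one
  show ?thesis
  proof (rule comm_groupI)
    fix X Y Z assume "X \<in> carrier ?K" "Y \<in> carrier ?K" "Z \<in> carrier ?K"
    then show "X \<otimes>\<^bsub>?K\<^esub> Y \<otimes>\<^bsub>?K\<^esub> Z = X \<otimes>\<^bsub>?K\<^esub> (Y \<otimes>\<^bsub>?K\<^esub> Z)"
      by (auto elim!: grothendieck_group_cases simp: cl m_assoc)
  next
    fix X assume "X \<in> carrier ?K"
    then obtain a b where ab: "a \<in> carrier G" "b \<in> carrier G" "X = groth_rel G `` {(a, b)}"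
      by (rule grothendieck_group_cases)
    have "((b \<otimes> a, a \<otimes> b), (\<one>, \<one>)) \<in> groth_rel G"
      using ab by (auto simp: groth_rel_def m_comm)
    then have "groth_rel G `` {(b \<otimes> a, a \<otimes> b)} = groth_rel G `` {(\<one>, \<one>)}"
      by (rule equiv_class_eq[OF equiv_groth_rel])
    then have "groth_rel G `` {(b, a)} \<otimes>\<^bsub>?K\<^esub> X = \<one>\<^bsub>?K\<^esub>" using ab by (simp add: cl)
    then show "\<exists>Y \<in> carrier ?K. Y \<otimes>\<^bsub>?K\<^esub> X = \<one>\<^bsub>?K\<^esub>" using ab groth_class_closed by blast
  qed (auto elim!: grothendieck_group_cases simp: cl m_comm)
qed

definition torsion_free_group :: "('a, 'c) monoid_scheme \<Rightarrow> bool"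
  where "torsion_free_group A \<longleftrightarrow>
    (\<forall>x \<in> carrier A. \<forall>n::nat. 0 < n \<longrightarrow> x [^]\<^bsub>A\<^esub> n = \<one>\<^bsub>A\<^esub> \<longrightarrow> x = \<one>\<^bsub>A\<^esub>)"

text \<open>
  Linear independence over the integers of a finite subset of an abelian group: \<open>x [^] k\<close> is the
  scalar multiple of \<open>x\<close> by the integer \<open>k\<close>. The rank is the supremum of the cardinalities of
  such subsets, with value \<open>\<infinity>\<close> if they are unbounded.
\<close>

definition Z_independent :: "('a, 'c) monoid_scheme \<Rightarrow> 'a set \<Rightarrow> bool"
  where "Z_independent A S \<longleftrightarrow> finite S \<and> S \<subseteq> carrier A \<and>
    (\<forall>k :: 'a \<Rightarrow> int. finprod A (\<lambda>x. x [^]\<^bsub>A\<^esub> k x) S = \<one>\<^bsub>A\<^esub> \<longrightarrow> (\<forall>x \<in> S. k x = 0))"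

definition group_rank :: "('a, 'c) monoid_scheme \<Rightarrow> enat"
  where "group_rank A = (SUP S \<in> Collect (Z_independent A). enat (card S))"

definition monoid_rank :: "('a, 'c) monoid_scheme \<Rightarrow> enat"
  where "monoid_rank M = group_rank (grothendieck_group M)"

definition torsion_free_monoid :: "('a, 'c) monoid_scheme \<Rightarrow> bool"
  where "torsion_free_monoid M \<longleftrightarrow> torsion_free_group (grothendieck_group M)"

section \<open>Monoid algebras\<close>

text \<open>
  The expression \<open>\<Sum>\<^sub>i c\<^sub>i x\<^bsup>q\<^sub>i\<^esup>\<close> is represented by its coefficient function, which has
  finite support contained in \<^term>\<open>carrier M\<close> and is zero outside \<^term>\<open>carrier M\<close>.
  Multiplication is convolution; restricting the index set to the supports makes it finite.
\<close>

definition monoid_algebra :: "('r, 'c) ring_scheme \<Rightarrow> ('m, 'd) monoid_scheme \<Rightarrow> ('m \<Rightarrow> 'r) ring"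
  where "monoid_algebra R M =
    \<lparr>carrier = {f. (\<forall>m. f m \<in> carrier R) \<and> {m. f m \<noteq> \<zero>\<^bsub>R\<^esub>} \<subseteq> carrier M \<and>
                   finite {m. f m \<noteq> \<zero>\<^bsub>R\<^esub>}},
     monoid.mult = (\<lambda>f g m. finsum R (\<lambda>(a, b). f a \<otimes>\<^bsub>R\<^esub> g b)
       {(a, b). f a \<noteq> \<zero>\<^bsub>R\<^esub> \<and> g b \<noteq> \<zero>\<^bsub>R\<^esub> \<and> a \<otimes>\<^bsub>M\<^esub> b = m}),
     one = (\<lambda>m. if m = \<one>\<^bsub>M\<^esub> then \<one>\<^bsub>R\<^esub> else \<zero>\<^bsub>R\<^esub>),
     zero = (\<lambda>m. \<zero>\<^bsub>R\<^esub>),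
     add = (\<lambda>f g m. f m \<oplus>\<^bsub>R\<^esub> g m)\<rparr>"

end

theory Submission
  imports Defs "HOL-Computational_Algebra.Polynomial_Factorial"
begin

text \<open>
  Choose an odd prime \<open>q \<noteq> p\<close>. There is a monic \<open>f\<close> over \<open>\<F>\<^sub>p\<close> with \<open>f(0) \<noteq> 0\<close> such that \<open>f(x\<^bsup>q\<^sup>n\<^esup>)\<close> is
  irreducible for all \<open>n\<close>: an irreducible divisor of the cyclotomic polynomial of order \<open>q\<^bsup>n+1\<^esup>\<close> has
  degree at least a constant multiple of \<open>q\<^sup>n\<close>, hence the process of passing from \<open>f\<close> to a proper
  factor of some \<open>f(x\<^bsup>q\<^sup>n\<^esup>)\<close> must stop.

  Let \<open>M\<close> be an atomic monoid of nonnegative elements of \<open>\<int>[1/(pq)]\<close> that contains all \<open>1/p\<^sup>k\<close>. Suppose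
  that a multiple of \<open>f\<close> in \<open>\<F>\<^sub>p[M]\<close> is a product of atoms. With exponents in \<open>\<nat>/(pq)\<^sup>t\<close> one has
  \<open>f = f(y\<^bsup>q\<^sup>t\<^esup>)\<^bsup>p\<^sup>t\<^esup>\<close> for \<open>y = x\<^bsup>1/(pq)\<^sup>t\<^esup>\<close>, so the prime polynomial \<open>f(y\<^bsup>q\<^sup>t\<^esup>) = f(x\<^bsup>1/p\<^sup>t\<^esup>)\<close> divides one of
  the atoms. As \<open>f(0) \<noteq> 0\<close> and \<open>1/p\<^sup>t \<in> M\<close>, the cofactor \<open>g\<close> lies in \<open>\<F>\<^sub>p[M]\<close>, and then that atom is
  \<open>f(x\<^bsup>1/p\<^bsup>t+1\<^esup>\<^esup>)\<^sup>p g\<close>, a contradiction.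
\<close>

hide_const (open) UnivPoly.coeff UnivPoly.monom Module.smult Divisibility.prime Divisibility.irreducible

section \<open>Multiplicative orders modulo prime powers\<close>

text \<open>With \<open>a = 1 + q * t\<close>, the power \<open>a ^ i\<close> is
  \<open>1 + i * q * t\<close> modulo \<open>q\<^sup>2\<close>. The exponents add up to
  \<open>q * (q - 1) / 2\<close>, a multiple of \<open>q\<close> because \<open>q\<close> is
  odd.\<close>

lemma sum_powers_cong_1_mod_square:
  fixes a q :: int
  assumes "odd q" "q dvd a - 1" "q > 0"
  shows "q\<^sup>2 dvd (\<Sum>i<nat q. a ^ i) - q"
proof -
  obtain t where t: "a = 1 + q * t" using assms(2) by (metis add.commute diff_add_cancel dvd_def)
  have pw: "q\<^sup>2 dvd a ^ i - (1 + int i * (q * t))" for i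
  proof (induction i)
    case (Suc i)
    have "a ^ Suc i - (1 + int (Suc i) * (q * t)) =
      a * (a ^ i - (1 + int i * (q * t))) + q\<^sup>2 * (int i * t\<^sup>2)"
      by (simp add: t algebra_simps power2_eq_square)
    then show ?case using Suc by simp
  qed simp
  have "(\<Sum>i<nat q. a ^ i) - (\<Sum>i<nat q. 1 + int i * (q * t)) =
      (\<Sum>i<nat q. a ^ i - (1 + int i * (q * t)))"
    by (simp add: sum_subtractf)
  then have 1: "q\<^sup>2 dvd (\<Sum>i<nat q. a ^ i) - (\<Sum>i<nat q. 1 + int i * (q * t))"
    using pw by (simp add: dvd_sum)
  obtain r where r: "q = 2 * r + 1" using assms(1) by (auto elim: oddE)
  have g: "2 * (\<Sum>i<n. int i) = int n * (int n - 1)" for n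
    by (induction n) (auto simp: algebra_simps)
  have "2 * (\<Sum>i<nat q. int i) = 2 * (q * r)" using g[of "nat q"] assms(3) r by simp
  then have "(\<Sum>i<nat q. int i) = q * r" by simp
  then have "(\<Sum>i<nat q. 1 + int i * (q * t)) = q + q * r * (q * t)"
    using assms(3) by (simp add: sum.distrib sum_distrib_right[symmetric])
  then have "(\<Sum>i<nat q. a ^ i) - q =
     ((\<Sum>i<nat q. a ^ i) - (\<Sum>i<nat q. 1 + int i * (q * t))) + q\<^sup>2 * (r * t)"
    by (simp add: power2_eq_square algebra_simps)
  then show ?thesis using 1 by (metis dvd_add dvd_triv_left)
qed

text \<open>One half of lifting the exponent, by strong induction on \<open>e\<close>. If
  \<open>q\<close> does not divide \<open>e\<close>, then \<open>(a ^ e - 1) / (a - 1)\<close> is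
  \<open>e\<close> modulo \<open>q\<close>, hence prime to \<open>q\<close>. If
  \<open>e = d * q\<close>, then \<open>(a ^ e - 1) / (a ^ d - 1)\<close> is \<open>q\<close> times
  a number that is \<open>1\<close> modulo \<open>q\<close>, so exactly one factor \<open>q\<close>
  is lost.\<close>

lemma prime_power_dvd_pow_minus_one:
  fixes a :: int and q :: nat
  assumes q: "Factorial_Ring.prime q" "odd q" and a: "int q dvd a - 1"
  shows "e > 0 \<Longrightarrow> int q ^ n dvd a ^ e - 1 \<Longrightarrow> int q ^ n dvd (a - 1) * int e"
proof (induction e arbitrary: n rule: less_induct)
  case (less e)
  have qp: "Factorial_Ring.prime (int q)" using q by simp
  have q0: "q > 1" using q prime_gt_1_nat by blast
  have pw: "int q dvd a ^ i - 1" for i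
  proof (induction i)
    case (Suc i)
    have "a ^ Suc i - 1 = a * (a ^ i - 1) + (a - 1)" by (simp add: algebra_simps)
    then show ?case using Suc a by (metis dvd_add dvd_mult)
  qed simp
  show ?case
  proof (cases "q dvd e")
    case False
    have "(\<Sum>i<e. a ^ i) = (\<Sum>i<e. a ^ i - 1) + int e" by (simp add: sum_subtractf)
    moreover have "int q dvd (\<Sum>i<e. a ^ i - 1)" using pw by (simp add: dvd_sum)
    ultimately have "\<not> int q dvd (\<Sum>i<e. a ^ i)" using False
      by (metis dvd_add_right_iff int_dvd_int_iff)
    then have "coprime (int q ^ n) (\<Sum>i<e. a ^ i)"
      using qp by (simp add: prime_imp_coprime)
    moreover have "a ^ e - 1 = (a - 1) * (\<Sum>i<e. a ^ i)" by (simp add: power_diff_1_eq)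
    ultimately have "int q ^ n dvd a - 1"
      using less.prems(2) by (metis coprime_dvd_mult_left_iff)
    then show ?thesis by simp
  next
    case True
    then obtain d where d: "e = d * q" by (metis dvd_def mult.commute)
    have d0: "d > 0" "d < e" using less.prems(1) d q0 by auto
    show ?thesis
    proof (cases n)
      case (Suc m)
      let ?S = "\<Sum>i<q. (a ^ d) ^ i"
      have "(int q)\<^sup>2 dvd ?S - int q"
        using sum_powers_cong_1_mod_square[of "int q" "a ^ d"] pw q q0 by simp
      then obtain s where s: "?S - int q = (int q)\<^sup>2 * s" by (auto simp: dvd_def)
      have S: "?S = int q * (1 + int q * s)" using s by (simp add: power2_eq_square algebra_simps)
      have "a ^ e - 1 = (a ^ d - 1) * ?S"
        by (simp add: d power_mult power_diff_1_eq)
      then have "int q * int q ^ m dvd int q * ((a ^ d - 1) * (1 + int q * s))"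
        using less.prems(2) Suc S by (simp add: mult.left_commute)
      then have "int q ^ m dvd (a ^ d - 1) * (1 + int q * s)"
        using q0 by (simp add: dvd_mult_cancel_left)
      moreover have "\<not> int q dvd 1 + int q * s"
        using qp by (metis dvd_add_left_iff dvd_triv_left not_prime_unit)
      then have "coprime (int q ^ m) (1 + int q * s)"
        using qp by (simp add: prime_imp_coprime)
      ultimately have "int q ^ m dvd a ^ d - 1" by (metis coprime_dvd_mult_left_iff)
      then have "int q ^ m dvd (a - 1) * int d" using less.IH[OF d0(2,1)] by blast
      then have "int q * int q ^ m dvd int q * ((a - 1) * int d)" by (rule mult_dvd_mono[OF dvd_refl])
      then show ?thesis using Suc d by (simp add: mult_ac)
    qed simp
  qed
qed

text \<open>Fermat makes \<open>p ^ (q - 1)\<close> congruent to \<open>1\<close> modulo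
  \<open>q\<close>, so the exponent can be lifted for this base. The factor in front of
  \<open>e\<close> does not depend on \<open>n\<close>, which later bounds degrees below by a
  multiple of \<open>q ^ n\<close>.\<close>

lemma prime_power_le_of_dvd_pow_minus_one:
  fixes p q :: nat
  assumes q: "Factorial_Ring.prime q" "odd q" and p: "Factorial_Ring.prime p" "p \<noteq> q"
    and e: "e > 0" "q ^ n dvd p ^ e - 1"
  shows "q ^ n \<le> (p ^ (q - 1) - 1) * e"
proof -
  have p_gt_1: "p > 1" "q > 1" using p q prime_gt_1_nat by blast+
  have "coprime q p" using p q by (simp add: primes_coprime)
  then have "[p ^ (q - 1) = 1] (mod q)"
    using fermat_theorem[OF q(1)] q(1) by (metis coprime_absorb_left not_prime_unit)
  then have A: "int q dvd int (p ^ (q - 1)) - 1"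
    by (metis cong_iff_dvd_diff cong_int_iff of_nat_1)
  have "int (q ^ n) dvd int (p ^ e) - 1"
    using e(2) p_gt_1 by (metis int_dvd_int_iff of_nat_1 of_nat_diff one_le_power order_less_imp_le)
  moreover have "int (p ^ e) - 1 dvd int (p ^ e) ^ (q - 1) - 1"
    by (simp only: power_diff_1_eq dvd_triv_left)
  ultimately have "int q ^ n dvd int (p ^ (q - 1)) ^ e - 1"
    by (metis dvd_trans of_nat_power power_commutes power_mult mult.commute)
  then have "int q ^ n dvd (int (p ^ (q - 1)) - 1) * int e"
    using prime_power_dvd_pow_minus_one[OF q A e(1)] by blast
  then have "int (q ^ n) dvd int ((p ^ (q - 1) - 1) * e)"
    using p_gt_1 by (simp add: of_nat_diff)
  then have "q ^ n dvd (p ^ (q - 1) - 1) * e" by (simp only: int_dvd_int_iff)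
  moreover have "p ^ (q - 1) > 1" using p_gt_1 by (intro one_less_power) auto
  ultimately show ?thesis using e(1) by (intro dvd_imp_le) auto
qed

section \<open>Integer polynomials modulo a prime and a monic polynomial\<close>

text \<open>
  \<open>mod_ideal p h\<close> is the ideal of the integer polynomials generated by \<open>p\<close> and \<open>h\<close>, so that
  \<open>prime_mod p h\<close> says that \<open>h\<close> is zero or prime over \<open>\<F>\<^sub>p\<close>.
\<close>

definition mod_ideal :: "nat \<Rightarrow> int poly \<Rightarrow> int poly set"
  where "mod_ideal p h = {f. \<exists>b. [:int p:] dvd f - h * b}"

definition prime_mod :: "nat \<Rightarrow> int poly \<Rightarrow> bool"
  where "prime_mod p h \<longleftrightarrow> 1 \<notin> mod_ideal p h \<and>
    (\<forall>a b. a * b \<in> mod_ideal p h \<longrightarrow> a \<in> mod_ideal p h \<or> b \<in> mod_ideal p h)"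

lemma mod_idealI: "[:int p:] dvd f - h * b \<Longrightarrow> f \<in> mod_ideal p h"
  by (auto simp: mod_ideal_def)

lemma mod_idealE:
  assumes "f \<in> mod_ideal p h" obtains b where "[:int p:] dvd f - h * b"
  using assms by (auto simp: mod_ideal_def)

lemma mod_ideal_generator [simp]: "h * b \<in> mod_ideal p h" "h \<in> mod_ideal p h"
  using mod_idealI[of p "h * b" h b] mod_idealI[of p h h 1] by auto

lemma mod_ideal_const: "[:int p:] dvd f \<Longrightarrow> f \<in> mod_ideal p h"
  using mod_idealI[of p f h 0] by simp

lemma mod_ideal_add: "f \<in> mod_ideal p h \<Longrightarrow> g \<in> mod_ideal p h \<Longrightarrow> f + g \<in> mod_ideal p h"
proof (elim mod_idealE)
  fix b c assume "[:int p:] dvd f - h * b" "[:int p:] dvd g - h * c"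
  then have "[:int p:] dvd (f - h * b) + (g - h * c)" by (rule dvd_add)
  then show ?thesis by (intro mod_idealI[of _ _ _ "b + c"]) (simp add: algebra_simps)
qed

lemma mod_ideal_mult: "f \<in> mod_ideal p h \<Longrightarrow> g * f \<in> mod_ideal p h"
proof (elim mod_idealE)
  fix b assume "[:int p:] dvd f - h * b"
  then have "[:int p:] dvd g * (f - h * b)" by (rule dvd_mult)
  then show ?thesis by (intro mod_idealI[of _ _ _ "g * b"]) (simp add: algebra_simps)
qed

lemma mod_ideal_mult2: "f \<in> mod_ideal p h \<Longrightarrow> f * g \<in> mod_ideal p h"
  using mod_ideal_mult[of f p h g] by (simp add: mult.commute)

lemma mod_ideal_diff: "f \<in> mod_ideal p h \<Longrightarrow> g \<in> mod_ideal p h \<Longrightarrow> f - g \<in> mod_ideal p h"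
  using mod_ideal_add[of f p h "- 1 * g"] mod_ideal_mult[of g p h "- 1"] by simp

lemma mod_ideal_cong: "f - g \<in> mod_ideal p h \<Longrightarrow> f \<in> mod_ideal p h \<longleftrightarrow> g \<in> mod_ideal p h"
  using mod_ideal_diff[of f p h "f - g"] mod_ideal_add[of "f - g" p h g] by auto

lemma mod_ideal_trans: "f \<in> mod_ideal p h \<Longrightarrow> h \<in> mod_ideal p k \<Longrightarrow> f \<in> mod_ideal p k"
proof (elim mod_idealE)
  fix b c assume "[:int p:] dvd f - h * b" "[:int p:] dvd h - k * c"
  then have "[:int p:] dvd (f - h * b) + (h - k * c) * b" by (intro dvd_add dvd_mult2)
  then show ?thesis by (intro mod_idealI[of _ _ _ "c * b"]) (simp add: algebra_simps)
qed

lemma prime_modD: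
  assumes "prime_mod p h" "a * b \<in> mod_ideal p h"
  shows "a \<in> mod_ideal p h \<or> b \<in> mod_ideal p h"
  using assms by (auto simp: prime_mod_def)

lemma prime_mod_prodD:
  assumes "prime_mod p h" "finite A" "prod f A \<in> mod_ideal p h"
  shows "\<exists>a\<in>A. f a \<in> mod_ideal p h"
  using assms(2,3)
proof (induction A rule: finite_induct)
  case empty then show ?case using assms(1) by (simp add: prime_mod_def)
next
  case (insert a A)
  then show ?case using prime_modD[OF assms(1), of "f a" "prod f A"] by auto
qed

lemma prime_mod_prod_listD:
  assumes "prime_mod p h" "prod_list xs \<in> mod_ideal p h"
  shows "\<exists>a\<in>set xs. a \<in> mod_ideal p h"
  using assms(2)
proof (induction xs)
  case Nil then show ?case using assms(1) by (simp add: prime_mod_def)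
next
  case (Cons a xs)
  then show ?case using prime_modD[OF assms(1), of a "prod_list xs"] by auto
qed

section \<open>Reduced coefficients and division by monic polynomials\<close>

definition reduce_coeffs :: "nat \<Rightarrow> int poly \<Rightarrow> int poly"
  where "reduce_coeffs p = map_poly (\<lambda>c. c mod int p)"

lemma coeff_reduce [simp]: "coeff (reduce_coeffs p f) i = coeff f i mod int p"
  by (simp add: reduce_coeffs_def coeff_map_poly)

lemma reduce_dvd: "[:int p:] dvd f - reduce_coeffs p f" "[:int p:] dvd reduce_coeffs p f - f"
  by (simp_all add: const_poly_dvd_iff mod_eq_dvd_iff[symmetric])

lemma degree_reduce_le: "degree (reduce_coeffs p f) \<le> degree f"
  by (rule degree_le) (simp add: coeff_eq_0)

lemma reduce_eq_0_iff: "reduce_coeffs p f = 0 \<longleftrightarrow> [:int p:] dvd f"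
  by (simp add: const_poly_dvd_iff poly_eq_iff mod_eq_0_iff_dvd)

lemma lead_coeff_reduce:
  assumes "\<not> [:int p:] dvd f"
  shows "\<not> int p dvd lead_coeff (reduce_coeffs p f)"
proof -
  have "reduce_coeffs p f \<noteq> 0" using assms by (simp add: reduce_eq_0_iff)
  then have "lead_coeff (reduce_coeffs p f) \<noteq> 0" by (simp only: leading_coeff_neq_0 not_False_eq_True)
  then show ?thesis by (metis coeff_reduce mod_eq_0_iff_dvd mod_mod_trivial)
qed

text \<open>Pseudo-division multiplies the dividend by a power of the leading coefficient, here
  \<open>1\<close>.\<close>

lemma monic_division:
  fixes h :: "int poly"
  assumes "lead_coeff h = 1"
  obtains d r where "f = h * d + r" "r = 0 \<or> degree r < degree h"
proof -
  have "h \<noteq> 0" using assms by auto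
  obtain d r where "pseudo_divmod f h = (d, r)" by (cases "pseudo_divmod f h")
  from pseudo_divmod[OF \<open>h \<noteq> 0\<close> this] show ?thesis using that assms by auto
qed

text \<open>In \<open>s = h * b\<close> modulo \<open>p\<close>, the cofactor may be reduced. If it
  is not zero then, its leading coefficient is prime to \<open>p\<close> and, as \<open>h\<close> is
  monic, occurs in the product at a degree beyond that of \<open>s\<close>.\<close>

lemma mod_ideal_small_degree:
  assumes h: "lead_coeff h = 1" and s: "s \<in> mod_ideal p h" "degree s < degree h"
  shows "[:int p:] dvd s"
proof -
  obtain b where b: "[:int p:] dvd s - h * b" using s by (elim mod_idealE)
  let ?b = "reduce_coeffs p b"
  have "[:int p:] dvd (s - h * b) + h * (b - ?b)" using b reduce_dvd by (intro dvd_add dvd_mult)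
  then have b': "[:int p:] dvd s - h * ?b" by (simp add: algebra_simps)
  show ?thesis
  proof (cases "?b = 0")
    case False
    then have "\<not> [:int p:] dvd b" by (simp add: reduce_eq_0_iff)
    then have nd: "\<not> int p dvd lead_coeff ?b" by (rule lead_coeff_reduce)
    have "int p dvd coeff (s - h * ?b) (degree h + degree ?b)"
      using b' by (simp add: const_poly_dvd_iff)
    moreover have "coeff s (degree h + degree ?b) = 0" using s(2) by (simp add: coeff_eq_0)
    moreover have "coeff (h * ?b) (degree h + degree ?b) = lead_coeff ?b"
      using h by (simp only: coeff_mult_degree_sum)
    ultimately show ?thesis using nd by simp
  qed (use b' in simp)
qed

lemma one_notin_mod_ideal:
  assumes "p > 1" "lead_coeff h = 1" "degree h > 0"
  shows "1 \<notin> mod_ideal p h"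
proof
  assume "1 \<in> mod_ideal p h"
  then have "[:int p:] dvd 1" by (rule mod_ideal_small_degree[OF assms(2)]) (use assms in simp)
  then show False using assms(1) by (auto simp: const_poly_dvd_iff dest!: spec[of _ 0])
qed

text \<open>The factor \<open>u\<close> inverts the leading coefficient modulo \<open>p\<close>. The
  product is reduced once more, because its leading coefficient is only congruent to
  \<open>1\<close>.\<close>

lemma monic_multiple_mod:
  assumes p: "Factorial_Ring.prime p" and r: "\<not> [:int p:] dvd r"
  obtains u m where "lead_coeff m = 1" "degree m \<le> degree r" "[:int p:] dvd m - smult u r"
proof -
  let ?r = "reduce_coeffs p r"
  have "\<not> int p dvd lead_coeff ?r" using r by (rule lead_coeff_reduce)
  then have "coprime (lead_coeff ?r) (int p)" using p
    by (metis coprime_commute prime_imp_coprime prime_nat_int_transfer)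
  then obtain u where u: "[lead_coeff ?r * u = 1] (mod int p)"
    using cong_solve_coprime_int by blast
  define m where "m = reduce_coeffs p (smult u ?r)"
  have p_gt_1: "p > 1" using p by (rule prime_gt_1_nat)
  have c: "coeff m (degree ?r) = 1" using u p_gt_1
    by (simp add: m_def cong_def mult.commute)
  have d: "degree m \<le> degree ?r"
    unfolding m_def by (rule order_trans[OF degree_reduce_le degree_smult_le])
  have deg: "degree m = degree ?r" using d le_degree[of m "degree ?r"] unfolding c by simp
  have "[:int p:] dvd (m - smult u ?r) + smult u (?r - r)"
    unfolding m_def using reduce_dvd by (intro dvd_add dvd_smult)
  then have "[:int p:] dvd m - smult u r" by (simp add: smult_diff_right)
  then show ?thesis using that[of m u] c deg degree_reduce_le[of p r] by simp
qed

text \<open>Let \<open>a * b\<close> be zero modulo \<open>p\<close> and \<open>h\<close> without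
  \<open>a\<close> or \<open>b\<close> being zero. Then the greatest common divisor \<open>g\<close>
  of \<open>a\<close> and \<open>h\<close> over the field of \<open>p\<close> elements is a proper
  factor: degree zero would make \<open>b\<close> zero, full degree would make \<open>a\<close>
  zero. Of \<open>g\<close> and its cofactor, one has at most half the degree of
  \<open>h\<close>.\<close>

lemma not_prime_mod_split:
  assumes p: "Factorial_Ring.prime p" and h: "lead_coeff h = 1" "degree h > 0" "\<not> prime_mod p h"
  obtains k where "lead_coeff k = 1" "degree k > 0" "2 * degree k \<le> degree h" "h \<in> mod_ideal p k"
proof -
  have p_gt_1: "p > 1" using p by (rule prime_gt_1_nat)
  obtain a b where ab: "a * b \<in> mod_ideal p h" "a \<notin> mod_ideal p h" "b \<notin> mod_ideal p h"
    using h one_notin_mod_ideal[OF p_gt_1 h(1,2)] by (auto simp: prime_mod_def)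
  \<comment> \<open>This is the ideal generated by \<open>p\<close>, \<open>h\<close> and
    \<open>a\<close>.\<close>
  define I where "I = {f. \<exists>c. f - a * c \<in> mod_ideal p h}"
  have Ih: "f \<in> I" if "f \<in> mod_ideal p h" for f
    using that by (auto simp: I_def intro: exI[of _ 0])
  have aI: "a \<in> I" by (auto simp: I_def intro!: exI[of _ 1] mod_ideal_const)
  have Imult: "g * f \<in> I" if f: "f \<in> I" for f g
  proof -
    obtain c where "f - a * c \<in> mod_ideal p h" using f by (auto simp: I_def)
    then have "g * (f - a * c) \<in> mod_ideal p h" by (rule mod_ideal_mult)
    then show ?thesis unfolding I_def by (auto intro!: exI[of _ "g * c"] simp: algebra_simps)
  qed
  have Iadd: "f + g \<in> I" if fg: "f \<in> I" "g \<in> I" for f g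
  proof -
    obtain c d where "f - a * c \<in> mod_ideal p h" "g - a * d \<in> mod_ideal p h"
      using fg by (auto simp: I_def)
    then have "(f - a * c) + (g - a * d) \<in> mod_ideal p h" by (rule mod_ideal_add)
    then show ?thesis unfolding I_def by (auto intro!: exI[of _ "c + d"] simp: algebra_simps)
  qed
  have Idiff: "f - g \<in> I" if "f \<in> I" "g \<in> I" for f g
    using Iadd[OF that(1) Imult[OF that(2), of "- 1"]] by simp
  have Ip: "[:int p:] dvd f \<Longrightarrow> f \<in> I" for f by (intro Ih mod_ideal_const)
  \<comment> \<open>Since \<open>h\<close> is a monic element of \<open>I\<close>, there is one of
    least degree; modulo \<open>p\<close> it generates \<open>I\<close>.\<close>
  obtain g where g: "g \<in> I" "lead_coeff g = 1"
      and gmin: "\<And>m. m \<in> I \<Longrightarrow> lead_coeff m = 1 \<Longrightarrow> degree g \<le> degree m"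
    using ex_has_least_nat[of "\<lambda>f. f \<in> I \<and> lead_coeff f = 1" h degree] Ih[of h] h by auto
  have Ig: "f \<in> mod_ideal p g" if f: "f \<in> I" for f
  proof -
    obtain d r where dr: "f = g * d + r" "r = 0 \<or> degree r < degree g"
      using monic_division[OF g(2)] by blast
    have rI: "r \<in> I" using Idiff[OF f Imult[OF g(1), of d]] dr by (simp add: mult.commute)
    have "[:int p:] dvd r"
    proof (rule ccontr)
      assume nd: "\<not> [:int p:] dvd r"
      then obtain u m where m: "lead_coeff m = 1" "degree m \<le> degree r" "[:int p:] dvd m - smult u r"
        using monic_multiple_mod[OF p] by blast
      have "smult u r \<in> I" using Imult[OF rI, of "[:u:]"] by simp
      then have "m \<in> I" using Iadd[OF Ip[OF m(3)]] by fastforce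
      then have "degree g \<le> degree r" using gmin m by fastforce
      then show False using dr(2) nd by auto
    qed
    then show ?thesis using dr by (intro mod_idealI[of _ _ _ d]) simp
  qed
  have dg0: "degree g > 0"
  proof (rule ccontr)
    assume "\<not> degree g > 0"
    then have "g = 1" using g(2) by (auto elim!: degree_eq_zeroE)
    then obtain c where "1 - a * c \<in> mod_ideal p h" using g(1) by (auto simp: I_def)
    then have "b * (1 - a * c) + c * (a * b) \<in> mod_ideal p h"
      by (rule mod_ideal_add[OF mod_ideal_mult mod_ideal_mult[OF ab(1)]])
    moreover have "b * (1 - a * c) + c * (a * b) = b" by (simp add: algebra_simps)
    ultimately show False using ab(3) by simp
  qed
  obtain k r where kr: "h = g * k + r" "r = 0 \<or> degree r < degree g"
    using monic_division[OF g(2)] by blast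
  have hg: "h \<in> mod_ideal p g" using Ig Ih by simp
  then have "r \<in> mod_ideal p g" using kr mod_ideal_cong[of h r p g] by simp
  then have r: "[:int p:] dvd r" using mod_ideal_small_degree[OF g(2)] kr(2) by blast
  have dgh: "degree g \<le> degree h" using gmin[OF Ih] h by simp
  \<comment> \<open>The remainder is zero only modulo \<open>p\<close>. Being of smaller degree than
    \<open>g\<close>, it changes neither the degree nor the leading coefficient of
    \<open>g * k\<close>, so \<open>k\<close> is monic over the integers.\<close>
  have k0: "k \<noteq> 0" using kr h(1) dgh by auto
  have dgk: "degree (g * k) = degree g + degree k"
    using g(2) k0 by (intro degree_mult_eq) auto
  have dgk': "degree h = degree (g * k)"
    using kr dgk by (auto simp: add.commute degree_add_eq_right)
  then have "lead_coeff h = lead_coeff (g * k)"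
    using kr dgk by (auto simp: coeff_eq_0)
  then have dh: "degree h = degree g + degree k" and lk: "lead_coeff k = 1"
    using dgk' dgk h(1) g(2) by (simp, metis lead_coeff_mult mult_1)
  have hk: "h \<in> mod_ideal p k" using kr r by (intro mod_idealI[of _ _ _ g]) (simp add: mult.commute)
  have hgk: "degree g < degree h"
  proof (rule ccontr)
    assume "\<not> degree g < degree h"
    then have "degree k = 0" using dh by simp
    then have "k = 1" using lk by (auto elim!: degree_eq_zeroE)
    then have "[:int p:] dvd g - h * 1" using kr r by (simp add: dvd_diff_commute)
    then have "g \<in> mod_ideal p h" by (rule mod_idealI)
    then show False using mod_ideal_trans[OF Ig[OF aI]] ab(2) by blast
  qed
  show ?thesis
  proof (cases "2 * degree g \<le> degree h")
    case True then show ?thesis using that g(2) dg0 hg by blast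
  next
    case False then show ?thesis using that lk hk hgk dh by fastforce
  qed
qed

section \<open>Residues and Fermat's theorem modulo \<open>p\<close> and \<open>h\<close>\<close>

text \<open>The disjunct \<open>r = 0\<close> admits the zero polynomial for \<open>e = 0\<close>
  too, so that the number of residues is always \<open>p ^ e\<close>.\<close>

definition residue_polys :: "nat \<Rightarrow> nat \<Rightarrow> int poly set"
  where "residue_polys p e = {r. (r = 0 \<or> degree r < e) \<and> (\<forall>i. coeff r i \<in> {0..<int p})}"

lemma residue_polys_card:
  assumes "p > 0"
  shows "finite (residue_polys p e)" "card (residue_polys p e) = p ^ e"
proof -
  \<comment> \<open>Residues correspond to coefficient lists of the fixed length \<open>e\<close>,
    padded with zeros.\<close>
  let ?L = "{xs. set xs \<subseteq> {0..<int p} \<and> length xs = e}"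
  have inj: "inj_on Poly ?L"
  proof (rule inj_onI)
    fix xs ys assume xy: "xs \<in> ?L" "ys \<in> ?L" "Poly xs = Poly ys"
    show "xs = ys"
    proof (rule nth_equalityI)
      fix i assume i: "i < length xs"
      have "nth_default 0 xs i = nth_default 0 ys i" using xy(3) by (metis coeff_Poly_eq)
      then show "xs ! i = ys ! i" using xy i by (simp add: nth_default_def)
    qed (use xy in simp)
  qed
  have im: "Poly ` ?L = residue_polys p e"
  proof (intro equalityI subsetI)
    fix r assume "r \<in> Poly ` ?L"
    then obtain xs where xs: "set xs \<subseteq> {0..<int p}" "length xs = e" "r = Poly xs" by auto
    have c: "coeff r i = (if i < e then xs ! i else 0)" for i
      using xs by (simp add: nth_default_def)
    have "r = 0 \<or> degree r < e"
      using c by (metis leading_coeff_0_iff)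
    moreover have "coeff r i \<in> {0..<int p}" for i
      unfolding c using xs assms by (auto dest!: nth_mem)
    ultimately show "r \<in> residue_polys p e" by (auto simp: residue_polys_def)
  next
    fix r assume r: "r \<in> residue_polys p e"
    let ?xs = "map (coeff r) [0..<e]"
    have "?xs \<in> ?L" using r by (auto simp: residue_polys_def)
    moreover have "r = Poly ?xs"
    proof (rule poly_eqI)
      fix i
      have "coeff r i = 0" if "i \<ge> e" using r that
        by (auto simp: residue_polys_def intro: coeff_eq_0)
      then show "coeff r i = coeff (Poly ?xs) i" by (simp add: nth_default_def)
    qed
    ultimately show "r \<in> Poly ` ?L" by blast
  qed
  show "finite (residue_polys p e)" unfolding im[symmetric]
    by (intro finite_imageI finite_lists_length_eq) simp
  show "card (residue_polys p e) = p ^ e" unfolding im[symmetric]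
    by (simp add: card_image[OF inj] card_lists_length_eq)
qed

lemma residue_poly_ex:
  assumes "p > 0" "lead_coeff h = 1"
  shows "\<exists>r\<in>residue_polys p (degree h). f - r \<in> mod_ideal p h"
proof -
  obtain d r where dr: "f = h * d + r" "r = 0 \<or> degree r < degree h"
    using monic_division[OF assms(2)] by blast
  have "reduce_coeffs p r \<in> residue_polys p (degree h)"
    using dr(2) degree_reduce_le[of p r] assms(1) by (auto simp: residue_polys_def reduce_eq_0_iff)
  moreover have "f - reduce_coeffs p r \<in> mod_ideal p h"
    using dr(1) reduce_dvd by (intro mod_idealI[of _ _ _ d]) simp
  ultimately show ?thesis by blast
qed

lemma residue_poly_unique:
  assumes "lead_coeff h = 1" "degree h > 0"
    and "r \<in> residue_polys p (degree h)" "s \<in> residue_polys p (degree h)" "r - s \<in> mod_ideal p h"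
  shows "r = s"
proof -
  have "degree (r - s) < degree h"
    using assms by (intro degree_diff_less) (auto simp: residue_polys_def)
  then have "[:int p:] dvd r - s" using mod_ideal_small_degree assms by blast
  then have "coeff r i mod int p = coeff s i mod int p" for i
    by (simp add: const_poly_dvd_iff mod_eq_dvd_iff)
  then show ?thesis using assms(3,4) by (simp add: residue_polys_def poly_eq_iff)
qed

lemma mod_ideal_prod_diff:
  assumes "finite A" "\<And>x. x \<in> A \<Longrightarrow> f x - g x \<in> mod_ideal p h"
  shows "prod f A - prod g A \<in> mod_ideal p h"
  using assms
proof (induction A rule: finite_induct)
  case (insert a A)
  have "f a * (prod f A - prod g A) + prod g A * (f a - g a) \<in> mod_ideal p h"
    using insert by (simp add: mod_ideal_add mod_ideal_mult)
  then show ?case using insert by (simp add: algebra_simps)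
qed (simp add: mod_ideal_const)

text \<open>
  Multiplication by \<open>f\<close> permutes the nonzero residues modulo \<open>p\<close> and \<open>h\<close>; compare the products of all residues.
\<close>

lemma fermat_mod_ideal:
  assumes p: "Factorial_Ring.prime p" and h: "lead_coeff h = 1" "degree h > 0" "prime_mod p h"
    and f: "f \<notin> mod_ideal p h"
  shows "f ^ (p ^ degree h - 1) - 1 \<in> mod_ideal p h"
proof -
  have p0: "p > 0" using p prime_gt_0_nat by blast
  define T where "T = residue_polys p (degree h) - {0}"
  have T: "finite T" "card T = p ^ degree h - 1"
    using residue_polys_card[OF p0, of "degree h"] p0
    by (simp_all add: T_def card_Diff_singleton residue_polys_def)
  have T0: "r \<notin> mod_ideal p h" if "r \<in> T" for r
    using residue_poly_unique[OF h(1,2), of r p 0] that p0 by (auto simp: T_def residue_polys_def)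
  have "\<exists>s. s \<in> T \<and> f * r - s \<in> mod_ideal p h" if "r \<in> T" for r
  proof -
    obtain s where s: "s \<in> residue_polys p (degree h)" "f * r - s \<in> mod_ideal p h"
      using residue_poly_ex[OF p0 h(1)] by blast
    moreover have "s \<noteq> 0" using s(2) prime_modD[OF h(3), of f r] f T0[OF that] by auto
    ultimately show ?thesis by (auto simp: T_def)
  qed
  then obtain \<sigma> where \<sigma>: "\<And>r. r \<in> T \<Longrightarrow> \<sigma> r \<in> T \<and> f * r - \<sigma> r \<in> mod_ideal p h" by metis
  have "inj_on \<sigma> T"
  proof (rule inj_onI)
    fix r s assume rs: "r \<in> T" "s \<in> T" "\<sigma> r = \<sigma> s"
    then have "(f * r - \<sigma> r) - (f * s - \<sigma> s) \<in> mod_ideal p h"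
      using \<sigma> by (metis mod_ideal_diff)
    then have "f * (r - s) \<in> mod_ideal p h" using rs by (simp add: algebra_simps)
    then have "r - s \<in> mod_ideal p h" using prime_modD[OF h(3)] f by blast
    then show "r = s" using residue_poly_unique[OF h(1,2)] rs by (auto simp: T_def)
  qed
  moreover have "\<sigma> ` T \<subseteq> T" using \<sigma> by auto
  ultimately have "bij_betw \<sigma> T T"
    using T(1) by (simp add: bij_betw_def endo_inj_surj)
  then have "prod \<sigma> T = prod id T" using prod.reindex_bij_betw[of \<sigma> T T id] by simp
  moreover have "prod (\<lambda>r. f * r) T - prod \<sigma> T \<in> mod_ideal p h"
    using T(1) \<sigma> by (intro mod_ideal_prod_diff) auto
  ultimately have "(f ^ card T - 1) * prod id T \<in> mod_ideal p h"
    by (simp add: prod.distrib algebra_simps)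
  \<comment> \<open>Primality cancels \<open>prod id T\<close>, none of whose factors is zero modulo
    \<open>p\<close> and \<open>h\<close>.\<close>
  then show ?thesis
    using prime_modD[OF h(3)] prime_mod_prodD[OF h(3) T(1), of id] T0 T(2) by fastforce
qed

section \<open>Degrees of the factors of cyclotomic polynomials modulo \<open>p\<close>\<close>

text \<open>For prime \<open>q\<close> this is the cyclotomic polynomial of order
  \<open>q ^ Suc n\<close>, the quotient of \<open>x ^ (q ^ Suc n) - 1\<close> by
  \<open>x ^ (q ^ n) - 1\<close>.\<close>

definition geom_poly :: "nat \<Rightarrow> nat \<Rightarrow> int poly"
  where "geom_poly q n = (\<Sum>i<q. ([:0, 1:] ^ (q ^ n)) ^ i)"

text \<open>In the finite field of classes modulo \<open>p\<close> and \<open>h\<close>, the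
  variable has order exactly \<open>q ^ Suc n\<close>, and this divides the number of nonzero
  classes.\<close>

lemma order_dvd:
  assumes p: "Factorial_Ring.prime p" and q: "Factorial_Ring.prime q" "q \<noteq> p"
    and h: "lead_coeff h = 1" "degree h > 0" "prime_mod p h" "geom_poly q n \<in> mod_ideal p h"
  shows "q ^ Suc n dvd p ^ degree h - 1"
proof (rule ccontr)
  assume nd: "\<not> ?thesis"
  let ?X = "[:0, 1:] :: int poly"
  let ?z = "?X ^ (q ^ n)"
  let ?N = "p ^ degree h - 1"
  have p_gt_1: "p > 1" "q > 1" using p q prime_gt_1_nat by blast+
  have one: "1 \<notin> mod_ideal p h" using h(3) by (simp add: prime_mod_def)
  \<comment> \<open>If the variable were zero, the cyclotomic polynomial would be
    \<open>1\<close>.\<close>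
  have X: "?X \<notin> mod_ideal p h"
  proof
    assume "?X \<in> mod_ideal p h"
    then have z: "?z \<in> mod_ideal p h"
      using mod_ideal_mult2[of ?X p h "?X ^ (q ^ n - 1)"] p_gt_1
      by (metis power_Suc Suc_diff_1 zero_less_power not_less0 less_trans zero_less_one)
    obtain r where r: "q = Suc r" using p_gt_1 by (cases q) auto
    have "geom_poly q n = 1 + ?z * (\<Sum>i<r. ?z ^ i)"
      unfolding geom_poly_def r by (subst sum.lessThan_Suc_shift) (simp add: sum_distrib_left)
    then have "geom_poly q n - 1 \<in> mod_ideal p h" using mod_ideal_mult2[OF z] by simp
    then show False using mod_ideal_cong h(4) one by blast
  qed
  have Xpow: "?X ^ k \<notin> mod_ideal p h" for k
  proof (induction k)
    case (Suc k) then show ?case using prime_modD[OF h(3), of ?X "?X ^ k"] X by auto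
  qed (use one in simp)
  have mult: "(?X ^ k) ^ i - 1 \<in> mod_ideal p h" if "?X ^ k - 1 \<in> mod_ideal p h" for k i
    using mod_ideal_mult2[OF that] by (simp add: power_diff_1_eq)
  have N: "?X ^ ?N - 1 \<in> mod_ideal p h" using fermat_mod_ideal[OF p h(1-3) X] .
  have "(?z - 1) * geom_poly q n = ?X ^ (q ^ Suc n) - 1"
    unfolding geom_poly_def power_diff_1_eq[symmetric] by (simp add: power_mult[symmetric] mult.commute)
  then have Q: "?X ^ (q ^ Suc n) - 1 \<in> mod_ideal p h" using mod_ideal_mult[OF h(4)] by metis
  let ?g = "gcd ?N (q ^ Suc n)"
  have "p ^ degree h > 1" using p_gt_1 h(2) by (intro one_less_power) auto
  then have "?N \<noteq> 0" by simp
  \<comment> \<open>Two powers of the variable are \<open>1\<close>, hence by Bezout so is the one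
    whose exponent is their greatest common divisor. If the claim fails, that divisor is a power of
    \<open>q\<close> dividing \<open>q ^ n\<close>.\<close>
  then obtain u v where uv: "?N * u = q ^ Suc n * v + ?g" using bezout_nat by blast
  have "?X ^ (?N * u) - 1 = ?X ^ (q ^ Suc n * v) * (?X ^ ?g - 1) + (?X ^ (q ^ Suc n * v) - 1)"
    unfolding uv by (simp add: power_add algebra_simps)
  moreover have "?X ^ (?N * u) - 1 \<in> mod_ideal p h" "?X ^ (q ^ Suc n * v) - 1 \<in> mod_ideal p h"
    using mult[OF N, of u] mult[OF Q, of v] by (simp_all only: power_mult)
  ultimately have "?X ^ (q ^ Suc n * v) * (?X ^ ?g - 1) \<in> mod_ideal p h"
    by (metis add_diff_cancel_right' mod_ideal_diff)
  then have g: "?X ^ ?g - 1 \<in> mod_ideal p h" using prime_modD[OF h(3)] Xpow by blast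
  obtain j where j: "j \<le> Suc n" "?g = q ^ j"
    using divides_primepow_nat[OF q(1)] by (metis gcd_dvd2)
  have "j \<noteq> Suc n" using nd j(2) by (metis gcd_dvd1)
  then have "q ^ n = q ^ j * q ^ (n - j)" using j(1) by (simp add: power_add[symmetric])
  then have z: "?z - 1 \<in> mod_ideal p h" using mult[OF g, of "q ^ (n - j)"] j(2)
    by (simp only: power_mult)
  \<comment> \<open>With \<open>?z = 1\<close> all \<open>q\<close> summands are \<open>1\<close>,
    so \<open>q\<close> would be zero modulo \<open>p\<close>.\<close>
  have "geom_poly q n - of_nat q = (\<Sum>i<q. ?z ^ i - 1)"
    by (simp add: geom_poly_def sum_subtractf)
  also have "\<dots> = (?z - 1) * (\<Sum>i<q. \<Sum>j<i. ?z ^ j)"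
    by (simp add: sum_distrib_left power_diff_1_eq)
  finally have "geom_poly q n - of_nat q \<in> mod_ideal p h" using mod_ideal_mult2[OF z] by metis
  then have "of_nat q \<in> mod_ideal p h" using mod_ideal_cong h(4) by blast
  then have "[:int p:] dvd of_nat q" by (rule mod_ideal_small_degree[OF h(1)]) (use h(2) in simp)
  then have "int p dvd int q" by (auto simp: of_nat_poly const_poly_dvd_iff dest!: spec[of _ 0])
  then show False using p q primes_dvd_imp_eq int_dvd_int_iff by blast
qed

text \<open>Descent to a prime factor: a polynomial that is not prime has a factor of smaller
  degree, which divides the same cyclotomic polynomial modulo \<open>p\<close>.\<close>

lemma degree_lower_bound:
  assumes p: "Factorial_Ring.prime p" and q: "Factorial_Ring.prime q" "odd q" "q \<noteq> p"
  shows "lead_coeff h = 1 \<Longrightarrow> degree h > 0 \<Longrightarrow> geom_poly q n \<in> mod_ideal p h \<Longrightarrow>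
    q ^ n \<le> (p ^ (q - 1) - 1) * degree h"
proof (induction "degree h" arbitrary: h rule: less_induct)
  case less
  show ?case
  proof (cases "prime_mod p h")
    case True
    have "q ^ Suc n dvd p ^ degree h - 1"
      using order_dvd[OF p q(1,3)] less.prems True by blast
    then have "q ^ Suc n \<le> (p ^ (q - 1) - 1) * degree h"
      using prime_power_le_of_dvd_pow_minus_one[OF q(1,2) p] q(3) less.prems(2) by blast
    moreover have "q ^ n \<le> q ^ Suc n" using q(1) prime_gt_0_nat by (intro power_increasing) (auto simp: Suc_leI)
    ultimately show ?thesis by linarith
  next
    case False
    then obtain k where k: "lead_coeff k = 1" "degree k > 0" "2 * degree k \<le> degree h" "h \<in> mod_ideal p k"
      using not_prime_mod_split[OF p less.prems(1,2)] by blast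
    have "q ^ n \<le> (p ^ (q - 1) - 1) * degree k"
      using less.hyps[of k] k mod_ideal_trans[OF less.prems(3) k(4)] by simp
    also have "\<dots> \<le> (p ^ (q - 1) - 1) * degree h" using k(3) by (intro mult_left_mono) auto
    finally show ?thesis .
  qed
qed

section \<open>Substituting powers of the variable\<close>

lemma pcompose_X_power: "([:0, 1:] ^ k) \<circ>\<^sub>p g = (g :: int poly) ^ k"
proof (induction k)
  case (Suc k)
  then show ?case by (simp only: power_Suc pcompose_mult) (simp add: pcompose_pCons)
qed (simp add: pcompose_1)

lemma pcompose_power: "((f :: int poly) ^ k) \<circ>\<^sub>p g = (f \<circ>\<^sub>p g) ^ k"
  by (induction k) (simp_all add: pcompose_1 pcompose_mult)

lemma pcompose_dvd: "[:int p:] dvd f \<Longrightarrow> [:int p:] dvd f \<circ>\<^sub>p g"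
  by (metis dvdE dvdI pcompose_const pcompose_mult)

lemma mod_ideal_pcompose: "f \<in> mod_ideal p h \<Longrightarrow> f \<circ>\<^sub>p g \<in> mod_ideal p (h \<circ>\<^sub>p g)"
proof (elim mod_idealE)
  fix b assume "[:int p:] dvd f - h * b"
  then have "[:int p:] dvd (f - h * b) \<circ>\<^sub>p g" by (rule pcompose_dvd)
  then show ?thesis
    by (intro mod_idealI[of _ _ _ "b \<circ>\<^sub>p g"]) (simp add: pcompose_diff pcompose_mult)
qed

lemma geom_poly_pcompose: "geom_poly q n \<circ>\<^sub>p [:0, 1:] ^ (q ^ m) = geom_poly q (n + m)"
  by (simp add: geom_poly_def pcompose_sum pcompose_power pcompose_X_power
      power_mult[symmetric] power_add mult_ac pcompose_pCons)

lemma geom_poly_0: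
  assumes "q > 1"
  shows "lead_coeff (geom_poly q 0) = 1" "degree (geom_poly q 0) > 0"
proof -
  have c: "coeff (geom_poly q 0) i = (if i < q then 1 else 0)" for i
  proof -
    have "geom_poly q 0 = (\<Sum>i<q. monom 1 i)" by (simp add: geom_poly_def monom_altdef)
    then show ?thesis by (simp add: coeff_sum)
  qed
  have "degree (geom_poly q 0) = q - 1"
    using assms by (intro antisym degree_le le_degree) (auto simp: c)
  then show "lead_coeff (geom_poly q 0) = 1" "degree (geom_poly q 0) > 0"
    using assms by (simp_all add: c)
qed

lemma monic_pcompose_X_power:
  assumes "lead_coeff (f :: int poly) = 1" "k > 0"
  shows "lead_coeff (f \<circ>\<^sub>p [:0, 1:] ^ k) = 1" "degree (f \<circ>\<^sub>p [:0, 1:] ^ k) = degree f * k"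
proof -
  have X: "[:0, 1:] ^ k = monom (1 :: int) k" by (simp add: monom_altdef)
  show "degree (f \<circ>\<^sub>p [:0, 1:] ^ k) = degree f * k"
    by (simp add: degree_pcompose X degree_monom_eq)
  show "lead_coeff (f \<circ>\<^sub>p [:0, 1:] ^ k) = 1"
    unfolding X using assms by (subst lead_coeff_comp) (simp_all add: degree_monom_eq)
qed

text \<open>
  If some substitution in \<open>f\<close> is not prime, it has a factor for which the quotient of the degree and
  \<open>q\<^sup>n\<close> is at most half of that for \<open>f\<close>; but this quotient is bounded below.
\<close>

lemma ex_persistent_prime_poly:
  assumes p: "Factorial_Ring.prime p" and q: "Factorial_Ring.prime q" "odd q" "q \<noteq> p"
  obtains f where "lead_coeff f = 1" "degree f > 0" "\<not> int p dvd coeff f 0"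
    "\<And>m. prime_mod p (f \<circ>\<^sub>p [:0, 1:] ^ (q ^ m))"
proof -
  have p_gt_1: "p > 1" "q > 1" using p q prime_gt_1_nat by blast+
  define C where "C n h \<longleftrightarrow> lead_coeff h = 1 \<and> degree h > 0 \<and> geom_poly q n \<in> mod_ideal p h" for n h
  have Cm: "C (n + m) (h \<circ>\<^sub>p [:0, 1:] ^ (q ^ m))" if "C n h" for n m h
    using that monic_pcompose_X_power[of h "q ^ m"] p_gt_1
      mod_ideal_pcompose[of "geom_poly q n" p h "[:0, 1:] ^ (q ^ m)"]
    by (simp add: C_def geom_poly_pcompose)
  have "\<exists>n f. C n f \<and> (\<forall>m. prime_mod p (f \<circ>\<^sub>p [:0, 1:] ^ (q ^ m)))"
  proof (rule ccontr)
    assume neg: "\<not> ?thesis"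
    let ?B = "degree (geom_poly q 0)"
    \<comment> \<open>Each round at least halves \<open>degree f / q ^ n\<close>; the first value is
      \<open>?B\<close>.\<close>
    have "\<exists>n f. C n f \<and> 2 ^ t * degree f \<le> ?B * q ^ n" for t :: nat
    proof (induction t)
      case 0
      have "C 0 (geom_poly q 0)" using geom_poly_0[OF p_gt_1(2)] by (simp add: C_def)
      then show ?case by (metis mult.commute power_0 mult_1 order_refl)
    next
      case (Suc t)
      then obtain n f where f: "C n f" "2 ^ t * degree f \<le> ?B * q ^ n" by blast
      obtain m where m: "\<not> prime_mod p (f \<circ>\<^sub>p [:0, 1:] ^ (q ^ m))" using neg f(1) by blast
      let ?h = "f \<circ>\<^sub>p [:0, 1:] ^ (q ^ m)"
      have h: "C (n + m) ?h" using Cm[OF f(1)] .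
      then obtain k where k: "lead_coeff k = 1" "degree k > 0" "2 * degree k \<le> degree ?h" "?h \<in> mod_ideal p k"
        using not_prime_mod_split[OF p _ _ m] unfolding C_def by blast
      have "C (n + m) k" using h k mod_ideal_trans by (auto simp: C_def)
      moreover have "2 ^ Suc t * degree k \<le> ?B * q ^ (n + m)"
      proof -
        have "2 ^ Suc t * degree k \<le> 2 ^ t * degree ?h" using k(3) by simp
        also have "\<dots> = (2 ^ t * degree f) * q ^ m"
          using monic_pcompose_X_power(2)[of f "q ^ m"] f(1) p_gt_1 by (simp add: C_def)
        also have "\<dots> \<le> (?B * q ^ n) * q ^ m" using f(2) by (rule mult_right_mono) simp
        finally show ?thesis by (simp add: power_add)
      qed
      ultimately show ?case by blast
    qed
    \<comment> \<open>For this number of rounds, say \<open>t\<close>, the lower bound on the degree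
      leads to \<open>2 ^ t \<le> t\<close>.\<close>
    then obtain n f where f: "C n f" "2 ^ ((p ^ (q - 1) - 1) * ?B) * degree f \<le> ?B * q ^ n" by blast
    let ?A = "p ^ (q - 1) - 1"
    have b: "q ^ n \<le> ?A * degree f" using degree_lower_bound[OF p q] f(1) by (auto simp: C_def)
    have "2 ^ (?A * ?B) * degree f \<le> (?A * ?B) * degree f"
    proof -
      have "?B * q ^ n \<le> ?B * (?A * degree f)" using b by (rule mult_left_mono) simp
      then show ?thesis using f(2) by (simp only: mult_ac)
    qed
    moreover have "degree f > 0" using f(1) by (simp add: C_def)
    ultimately have "2 ^ (?A * ?B) \<le> ?A * ?B" by (simp only: mult_le_cancel2)
    then show False using less_exp[of "?A * ?B"] by linarith
  qed
  then obtain n f where f: "C n f" "\<And>m. prime_mod p (f \<circ>\<^sub>p [:0, 1:] ^ (q ^ m))" by blast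
  \<comment> \<open>Modulo \<open>p\<close>, the polynomial \<open>f\<close> divides
    \<open>geom_poly q n\<close>, whose constant term is \<open>1\<close>.\<close>
  have "\<not> int p dvd coeff f 0"
  proof
    assume d: "int p dvd coeff f 0"
    obtain b where "[:int p:] dvd geom_poly q n - f * b"
      using f(1) by (auto simp: C_def elim: mod_idealE)
    then have "int p dvd coeff (geom_poly q n - f * b) 0" by (simp only: const_poly_dvd_iff)
    moreover have "coeff (geom_poly q n) 0 = 1"
    proof -
      have "coeff (geom_poly q n) 0 = poly (geom_poly q n) 0" by (simp add: poly_0_coeff_0)
      also have "\<dots> = (\<Sum>i<q. (0 :: int) ^ i)"
        using p_gt_1 by (simp add: geom_poly_def poly_sum zero_power)
      also have "\<dots> = 1" using p_gt_1 by (simp add: power_0_left)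
      finally show ?thesis .
    qed
    ultimately have "int p dvd 1 - coeff f 0 * coeff b 0" by (simp add: coeff_mult_0)
    then have "int p dvd (1 - coeff f 0 * coeff b 0) + coeff f 0 * coeff b 0"
      using d by (intro dvd_add dvd_mult2)
    then show False using p_gt_1 by simp
  qed
  then show ?thesis using that f unfolding C_def by blast
qed

section \<open>An atomic monoid of rational numbers\<close>

locale prime_pair =
  fixes p q :: nat
  assumes p: "Factorial_Ring.prime p" and q: "Factorial_Ring.prime q" "odd q" "q \<noteq> p"
begin

lemma p_gt_1: "p > 1" and q_gt_2: "q > 2"
proof -
  show "p > 1" using p by (rule prime_gt_1_nat)
  have "q \<noteq> 2" using q(2) by auto
  then show "q > 2" using prime_gt_1_nat[OF q(1)] by linarith
qed

text \<open>
  The exponents of \<open>q\<close> grow so fast that \<open>q\<close> to the power of the \<open>k\<close>-th gap, \<open>p (k + 1)\<close>, exceeds every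
  multiplicity with which the \<open>k\<close>-th generators can occur in a sum equal to a generator.
\<close>

primrec q_exponent :: "nat \<Rightarrow> nat" where
  "q_exponent 0 = 0"
| "q_exponent (Suc k) = q_exponent k + p * Suc k"

definition half :: "nat \<Rightarrow> nat" where "half k = (q ^ q_exponent (Suc k) - 1) div 2"

lemma half: "2 * half k + 1 = q ^ q_exponent (Suc k)" and half_pos: "half k \<ge> 1"
proof -
  have "odd (q ^ q_exponent (Suc k))" using q by simp
  then show 1: "2 * half k + 1 = q ^ q_exponent (Suc k)"
    unfolding half_def by (metis odd_two_times_div_two_succ add_diff_cancel_right' even_Suc even_two_times_div_two Suc_eq_plus1 oddE)
  have "q ^ q_exponent (Suc k) \<ge> q ^ 1" using q_gt_2 p_gt_1 by (intro power_increasing) auto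
  then show "half k \<ge> 1" using 1 q_gt_2 by simp
qed

text \<open>The two numerators of index \<open>k\<close> sum to
  \<open>q ^ q_exponent (Suc k)\<close>. So the pair sums to \<open>1 / p ^ Suc k\<close>, which
  brings the inverse powers of \<open>p\<close> into the monoid without making them
  generators.\<close>

fun gen :: "bool \<times> nat \<Rightarrow> rat" where
  "gen (b, k) = of_nat (if b then half k else half k + 1) / of_nat (q ^ q_exponent (Suc k) * p ^ Suc k)"

lemma gen_add: "gen (True, k) + gen (False, k) = 1 / of_nat (p ^ Suc k)"
proof -
  have "gen (True, k) + gen (False, k) = of_nat (2 * half k + 1) / of_nat (q ^ q_exponent (Suc k) * p ^ Suc k)"
    by (simp add: add_divide_distrib[symmetric] del: q_exponent.simps)
  then show ?thesis unfolding half using q_gt_2 by simp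
qed

text \<open>These bounds limit how often a generator can occur in a sum whose value is again a
  generator.\<close>

lemma gen_lower: "gen c \<ge> 1 / (3 * of_nat (p ^ Suc (snd c)))"
  and gen_upper: "gen c \<le> 2 / (3 * of_nat (p ^ Suc (snd c)))"
proof -
  obtain b k where c: "c = (b, k)" by (cases c)
  let ?w = "if b then half k else half k + 1"
  let ?Q = "q ^ q_exponent (Suc k)"
  have Q: "?Q > 0" "p ^ Suc k > 0" using q_gt_2 p_gt_1 by auto
  \<comment> \<open>As \<open>half k \<ge> 1\<close>, both numerators lie between one third and two
    thirds of \<open>2 * half k + 1\<close>.\<close>
  have "?Q \<le> 3 * ?w" "3 * ?w \<le> 2 * ?Q" unfolding half[symmetric] using half_pos[of k] by auto
  then have "of_nat ?Q \<le> (of_nat (3 * ?w) :: rat)" "(of_nat (3 * ?w) :: rat) \<le> of_nat (2 * ?Q)"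
    by (simp_all only: of_nat_le_iff)
  moreover have "(of_nat ?Q :: rat) > 0" "(of_nat (p ^ Suc k) :: rat) > 0"
    using Q by (simp_all only: of_nat_0_less_iff)
  ultimately show "gen c \<ge> 1 / (3 * of_nat (p ^ Suc (snd c)))" "gen c \<le> 2 / (3 * of_nat (p ^ Suc (snd c)))"
    unfolding c gen.simps snd_conv of_nat_mult by (simp_all add: field_simps del: q_exponent.simps power_Suc of_nat_power)
qed

lemma gen_pos: "gen c > 0"
proof -
  have "(0 :: rat) < 1 / (3 * of_nat (p ^ Suc (snd c)))" using p_gt_1 by simp
  then show ?thesis using gen_lower[of c] by linarith
qed

section \<open>Denominators at \<open>q\<close>\<close>

text \<open>The group of rationals whose denominator has a \<open>q\<close>-part dividing
  \<open>q ^ l\<close> and is otherwise a power of \<open>p\<close>.\<close>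

definition loc :: "nat \<Rightarrow> rat set"
  where "loc l = {x. \<exists>e. of_nat (q ^ l * p ^ e) * x \<in> \<int>}"

lemma loc_add:
  assumes "x \<in> loc l" "y \<in> loc l"
  shows "x + y \<in> loc l"
proof -
  obtain d e where de: "of_nat (q ^ l * p ^ d) * x \<in> \<int>" "of_nat (q ^ l * p ^ e) * y \<in> \<int>"
    using assms by (auto simp: loc_def)
  have "of_nat (p ^ e) * (of_nat (q ^ l * p ^ d) * x) + of_nat (p ^ d) * (of_nat (q ^ l * p ^ e) * y) \<in> \<int>"
    by (rule Ints_add[OF Ints_mult[OF Ints_of_nat de(1)] Ints_mult[OF Ints_of_nat de(2)]])
  then have "of_nat (q ^ l * p ^ (d + e)) * (x + y) \<in> \<int>"
    by (simp add: algebra_simps power_add)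
  then show ?thesis unfolding loc_def by blast
qed

lemma loc_int_mult: "x \<in> loc l \<Longrightarrow> of_int d * x \<in> loc l"
proof -
  assume "x \<in> loc l"
  then obtain e where "of_nat (q ^ l * p ^ e) * x \<in> \<int>" by (auto simp: loc_def)
  then have "of_int d * (of_nat (q ^ l * p ^ e) * x) \<in> \<int>" by (rule Ints_mult[OF Ints_of_int])
  then have "of_nat (q ^ l * p ^ e) * (of_int d * x) \<in> \<int>" by (simp only: mult_ac)
  then show ?thesis unfolding loc_def by blast
qed

lemma loc_diff: "x \<in> loc l \<Longrightarrow> y \<in> loc l \<Longrightarrow> x - y \<in> loc l"
  using loc_add[of x l "- y"] loc_int_mult[of y l "- 1"] by simp

lemma loc_0: "0 \<in> loc l" by (simp add: loc_def)

lemma loc_sum: "(\<And>i. i \<in> A \<Longrightarrow> f i \<in> loc l) \<Longrightarrow> sum f A \<in> loc l"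
  by (induction A rule: infinite_finite_induct) (auto intro: loc_add loc_0)

lemma loc_mono: "k \<le> l \<Longrightarrow> loc k \<subseteq> loc l"
proof
  fix x assume "k \<le> l" "x \<in> loc k"
  then obtain e where "of_nat (q ^ k * p ^ e) * x \<in> \<int>" by (auto simp: loc_def)
  then have "of_nat (q ^ (l - k)) * (of_nat (q ^ k * p ^ e) * x) \<in> \<int>" by (rule Ints_mult[OF Ints_of_nat])
  moreover have "q ^ l = q ^ (l - k) * q ^ k" using \<open>k \<le> l\<close> by (simp add: power_add[symmetric])
  ultimately have "of_nat (q ^ l * p ^ e) * x \<in> \<int>" by (simp add: mult_ac)
  then show "x \<in> loc l" unfolding loc_def by blast
qed

lemma gen_loc: "gen (b, k) \<in> loc (q_exponent (Suc k))"
proof -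
  have "of_nat (q ^ q_exponent (Suc k) * p ^ Suc k) * gen (b, k) = of_nat (if b then half k else half k + 1)"
    using q_gt_2 p_gt_1 by (simp del: q_exponent.simps)
  then show ?thesis unfolding loc_def by (metis (mono_tags, lifting) Ints_of_nat mem_Collect_eq)
qed

lemma inverse_power_loc: "1 / of_nat (p ^ k) \<in> loc 0"
  using p_gt_1 by (auto simp: loc_def intro!: exI[of _ k])

lemma coprime_half: "coprime (int q) (int (half k))"
proof -
  have "\<not> q dvd half k"
  proof
    assume d: "q dvd half k"
    have "q dvd q ^ q_exponent (Suc k)" using p_gt_1 by (simp add: dvd_power)
    then have "q dvd 2 * half k + 1" by (simp only: half)
    then have "q dvd 1" using d by (metis dvd_add_right_iff dvd_mult)
    then show False using q_gt_2 by simp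
  qed
  then show ?thesis using q(1) prime_imp_coprime by (simp only: coprime_int_iff) blast
qed

text \<open>Since \<open>half k\<close> is prime to \<open>q\<close>, the \<open>q\<close>-part of
  the denominator of \<open>gen (True, k)\<close> is exactly \<open>q ^ q_exponent (Suc k)\<close>.
  To reach the smaller group, \<open>d\<close> must cancel the whole gap.\<close>

lemma dvd_of_mult_gen_loc:
  assumes "of_int d * gen (True, k) \<in> loc (q_exponent k)"
  shows "int q ^ (p * Suc k) dvd d"
proof -
  obtain e z where z: "of_nat (q ^ q_exponent k * p ^ e) * (of_int d * gen (True, k)) = of_int z"
    using assms unfolding loc_def by (auto elim: Ints_cases)
  have nz: "(of_nat q :: rat) \<noteq> 0" "(of_nat p :: rat) \<noteq> 0" using p_gt_1 q_gt_2 by auto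
  have "of_int (int p ^ e * d * int (half k)) =
      of_nat (q ^ q_exponent k * p ^ e) * (of_int d * gen (True, k)) * of_int (int q ^ (p * Suc k) * int p ^ Suc k)"
    using nz by (simp add: field_simps power_add)
  also have "\<dots> = of_int (z * (int q ^ (p * Suc k) * int p ^ Suc k))"
    unfolding z by simp
  finally have "int p ^ e * d * int (half k) = z * (int q ^ (p * Suc k) * int p ^ Suc k)"
    by (simp only: of_int_eq_iff)
  then have "int q ^ (p * Suc k) dvd int p ^ e * d * int (half k)" by (metis dvd_triv_left mult.left_commute mult.assoc)
  moreover have "coprime (int q) (int p)" using p q by (simp add: primes_coprime)
  ultimately show ?thesis using coprime_half[of k]
    by (metis coprime_dvd_mult_left_iff coprime_dvd_mult_right_iff coprime_power_left_iff coprime_power_right_iff)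
qed

text \<open>
  The \<open>q\<close>-adic denominator of the last summand exceeds those of all others by more than a small
  coefficient can cancel.
\<close>

lemma gen_independent:
  "(\<Sum>k<n. of_int (d k) * gen (True, k)) \<in> loc 0 \<Longrightarrow>
   (\<And>k. k < n \<Longrightarrow> \<bar>d k\<bar> < int q ^ (p * Suc k)) \<Longrightarrow> k < n \<Longrightarrow> d k = 0"
proof (induction n)
  case (Suc n)
  have mono: "q_exponent (Suc i) \<le> q_exponent j" if "i < j" for i j
    using lift_Suc_mono_le[of q_exponent "Suc i" j] that by simp
  have "(\<Sum>k<n. of_int (d k) * gen (True, k)) \<in> loc (q_exponent n)"
    using gen_loc loc_mono[OF mono] by (intro loc_sum loc_int_mult) blast
  moreover have "(\<Sum>k<Suc n. of_int (d k) * gen (True, k)) \<in> loc (q_exponent n)"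
    using Suc.prems(1) loc_mono by blast
  ultimately have "of_int (d n) * gen (True, n) \<in> loc (q_exponent n)"
    using loc_diff by fastforce
  then have "int q ^ (p * Suc n) dvd d n" by (rule dvd_of_mult_gen_loc)
  then have dn: "d n = 0" using Suc.prems(2)[of n] dvd_imp_le_int[of "d n" "int q ^ (p * Suc n)"] by fastforce
  then show ?case using Suc by (cases "k = n") auto
qed simp

section \<open>Sums of generators and their uniqueness\<close>

definition val :: "(bool \<times> nat) list \<Rightarrow> rat" where "val xs = sum_list (map gen xs)"

text \<open>Modulo \<open>loc 0\<close>, the two generators of index \<open>k\<close> are negatives
  of each other; this is the resulting coefficient of \<open>gen (True, k)\<close>.\<close>

definition diff_count :: "(bool \<times> nat) list \<Rightarrow> nat \<Rightarrow> int"
  where "diff_count xs k = int (count_list xs (True, k)) - int (count_list xs (False, k))"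

lemma val_simps [simp]: "val [] = 0" "val (c # xs) = gen c + val xs" "val (xs @ ys) = val xs + val ys"
  by (simp_all add: val_def)

lemma val_nonneg: "val xs \<ge> 0"
  unfolding val_def by (rule sum_list_nonneg) (auto intro: less_imp_le gen_pos simp del: gen.simps)

lemma val_eq_0_iff: "val xs = 0 \<longleftrightarrow> xs = []"
  using gen_pos[of "hd xs"] val_nonneg[of "tl xs"] by (cases xs) auto

lemma val_loc:
  "set xs \<subseteq> UNIV \<times> {..<n} \<Longrightarrow> val xs - (\<Sum>k<n. of_int (diff_count xs k) * gen (True, k)) \<in> loc 0"
proof (induction xs)
  case Nil then show ?case by (simp add: diff_count_def loc_0)
next
  case (Cons c xs)
  obtain b i where c: "c = (b, i)" "i < n" using Cons.prems by (cases c) auto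
  have IH: "val xs - (\<Sum>k<n. of_int (diff_count xs k) * gen (True, k)) \<in> loc 0" using Cons by simp
  have "(\<Sum>k<n. of_int (diff_count (c # xs) k) * gen (True, k)) =
      (\<Sum>k<n. of_int (diff_count xs k) * gen (True, k) + (if k = i then (if b then 1 else -1) * gen (True, i) else 0))"
    by (rule sum.cong) (auto simp: diff_count_def c algebra_simps simp del: gen.simps)
  also have "\<dots> = (\<Sum>k<n. of_int (diff_count xs k) * gen (True, k)) + (if b then 1 else -1) * gen (True, i)"
    using c(2) by (simp add: sum.distrib del: gen.simps)
  finally have eq: "val (c # xs) - (\<Sum>k<n. of_int (diff_count (c # xs) k) * gen (True, k)) =
     (val xs - (\<Sum>k<n. of_int (diff_count xs k) * gen (True, k))) + (if b then 0 else 1 / of_nat (p ^ Suc i))"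
    using gen_add[of i] by (auto simp: c(1) simp del: gen.simps)
  show ?case unfolding eq using loc_add[OF IH] inverse_power_loc[of "Suc i"] loc_0 by (simp del: power_Suc of_nat_power)
qed

lemma count_gen_le_val: "of_nat (count_list xs c) * gen c \<le> val xs"
proof (induction xs)
  case (Cons a xs)
  then show ?case using gen_pos[of a] by (auto simp: algebra_simps simp del: gen.simps)
qed simp

text \<open>A generator is at most \<open>1 / 3\<close>, and every copy of \<open>gen (b, k)\<close>
  takes at least \<open>1 / (3 * p ^ Suc k)\<close> of it.\<close>

lemma count_bound:
  assumes "val xs = gen c"
  shows "count_list xs (b, k) \<le> p ^ Suc k"
proof -
  let ?P = "of_nat (p ^ Suc k) :: rat"
  have P: "?P > 0" using p_gt_1 by simp
  have "p ^ Suc (snd c) \<ge> p ^ 1" using p_gt_1 by (intro power_increasing) auto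
  then have "p ^ Suc (snd c) \<ge> 2" using p_gt_1 unfolding power_one_right by linarith
  then have "(of_nat 2 :: rat) \<le> of_nat (p ^ Suc (snd c))" by (simp only: of_nat_le_iff)
  moreover have "2 / (3 * r) \<le> 1 / 3" if "2 \<le> r" for r :: rat using that by (simp add: field_simps)
  ultimately have "2 / (3 * of_nat (p ^ Suc (snd c))) \<le> (1 / 3 :: rat)" unfolding of_nat_numeral by blast
  then have "val xs \<le> 1 / 3" unfolding assms using gen_upper order_trans by blast
  moreover have "of_nat (count_list xs (b, k)) * (1 / (3 * ?P)) \<le> of_nat (count_list xs (b, k)) * gen (b, k)"
    using gen_lower[of "(b, k)"] by (intro mult_left_mono) simp_all
  ultimately have "of_nat (count_list xs (b, k)) * (1 / (3 * ?P)) \<le> 1 / 3"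
    using count_gen_le_val[of xs "(b, k)"] by linarith
  then have "of_nat (count_list xs (b, k)) \<le> ?P"
    using P by (simp add: field_simps del: of_nat_power power_Suc)
  then show ?thesis by (simp only: of_nat_le_iff)
qed

text \<open>Modulo \<open>loc 0\<close>, both sides are combinations of the
  \<open>gen (True, k)\<close>, with coefficients too close together to differ, by
  \<open>gen_independent\<close>. Thus \<open>c\<close> occurs in \<open>xs\<close>, and positivity
  leaves room for nothing else.\<close>

lemma val_eq_genD:
  assumes v: "val xs = gen c"
  shows "xs = [c]"
proof -
  have "finite (snd ` (set (c # xs)))" by simp
  then obtain n where n: "\<forall>k \<in> snd ` set (c # xs). k < n"
    unfolding finite_nat_set_iff_bounded by blast
  then have sets: "set xs \<subseteq> UNIV \<times> {..<n}" "set [c] \<subseteq> UNIV \<times> {..<n}" by force+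
  define d where "d k = diff_count xs k - diff_count [c] k" for k
  have "(val [c] - (\<Sum>k<n. of_int (diff_count [c] k) * gen (True, k))) -
      (val xs - (\<Sum>k<n. of_int (diff_count xs k) * gen (True, k))) \<in> loc 0"
    by (rule loc_diff[OF val_loc[OF sets(2)] val_loc[OF sets(1)]])
  then have "(\<Sum>k<n. of_int (d k) * gen (True, k)) \<in> loc 0"
    using v by (simp add: d_def sum_subtractf left_diff_distrib del: gen.simps)
  moreover have "\<bar>d k\<bar> < int q ^ (p * Suc k)" for k
  proof -
    have "\<bar>diff_count xs k\<bar> \<le> int (p ^ Suc k)"
      using count_bound[OF v, of True k] count_bound[OF v, of False k] unfolding diff_count_def by linarith
    moreover have "\<bar>diff_count [c] k\<bar> \<le> 1" by (simp add: diff_count_def)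
    \<comment> \<open>The factor \<open>p\<close> in the gaps of \<open>q_exponent\<close> serves
      here, through \<open>p < 2 ^ p\<close> and \<open>2 < q\<close>.\<close>
    moreover have "p ^ Suc k < (2 ^ p) ^ Suc k" by (intro power_strict_mono less_exp) auto
    then have "p ^ Suc k + 1 \<le> 2 ^ (p * Suc k)" by (simp only: power_mult)
    moreover have "2 ^ (p * Suc k) < q ^ (p * Suc k)" using q_gt_2 p_gt_1 by (intro power_strict_mono) auto
    ultimately have "\<bar>d k\<bar> < int (q ^ (p * Suc k))" unfolding d_def by linarith
    then show ?thesis by simp
  qed
  ultimately have "d (snd c) = 0" using gen_independent[of d n "snd c"] n by simp
  \<comment> \<open>Without \<open>c\<close>, only its partner could contribute at this index, and
    with the opposite sign.\<close>
  have cx: "c \<in> set xs"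
  proof (rule ccontr)
    assume "c \<notin> set xs"
    then have "count_list xs c = 0" by (simp add: count_list_0_iff)
    then show False using \<open>d (snd c) = 0\<close>
      by (cases c; cases "fst c") (auto simp: d_def diff_count_def)
  qed
  then obtain ys zs where xs: "xs = ys @ c # zs" by (metis split_list)
  then have "val ys + val zs = 0" using v by (simp del: gen.simps)
  then show ?thesis using xs val_nonneg[of ys] val_nonneg[of zs] val_eq_0_iff[of ys] val_eq_0_iff[of zs] by simp
qed

section \<open>The monoid and its atoms\<close>

definition Mon :: "rat monoid"
  where "Mon = \<lparr>carrier = range val, monoid.mult = (+), one = 0\<rparr>"

lemma Mon_simps [simp]: "carrier Mon = range val" "x \<otimes>\<^bsub>Mon\<^esub> y = x + y" "\<one>\<^bsub>Mon\<^esub> = 0"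
  by (simp_all add: Mon_def)

lemma range_val_add: "x \<in> range val \<Longrightarrow> y \<in> range val \<Longrightarrow> x + y \<in> range val"
  by (auto simp flip: val_simps(3))

lemma range_val_0: "0 \<in> range val" using rangeI[of val "[]"] by simp

lemma range_val_mult:
  assumes "x \<in> range val"
  shows "of_nat n * x \<in> range val"
proof (induction n)
  case 0
  show ?case unfolding of_nat_0 mult_zero_left by (rule range_val_0)
next
  case (Suc n)
  have eq: "of_nat (Suc n) * x = x + of_nat n * x" by (simp add: algebra_simps)
  show ?case unfolding eq by (rule range_val_add[OF assms Suc.IH])
qed

lemma inverse_power_in_range_val: "1 / of_nat (p ^ k) \<in> range val"
proof (cases k)
  case 0
  \<comment> \<open>No pair of generators sums to \<open>1\<close>, which is obtained as
    \<open>p\<close> times \<open>1 / p\<close>.\<close>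
  have "1 / of_nat (p ^ Suc 0) = val [(True, 0), (False, 0)]" using gen_add[of 0] by simp
  then have "of_nat p * (1 / of_nat (p ^ Suc 0)) \<in> range val" using range_val_mult by blast
  then show ?thesis using 0 p_gt_1 by simp
next
  case (Suc j)
  have "1 / of_nat (p ^ k) = val [(True, j), (False, j)]" using gen_add[of j] Suc by simp
  then show ?thesis by blast
qed

text \<open>The form with all large \<open>s\<close> allows finitely many elements to share one
  denominator.\<close>

lemma range_val_denominator:
  assumes "x \<in> range val"
  shows "\<exists>t. \<forall>s\<ge>t. \<exists>n. x * of_nat ((p * q) ^ s) = of_nat n"
proof -
  obtain xs where "x = val xs" using assms by blast
  moreover have "\<exists>t. \<forall>s\<ge>t. \<exists>n. val xs * of_nat ((p * q) ^ s) = of_nat n" for xs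
  proof (induction xs)
    case (Cons c xs)
    obtain b k where c: "c = (b, k)" by (cases c)
    obtain t where t: "\<And>s. s \<ge> t \<Longrightarrow> \<exists>n. val xs * of_nat ((p * q) ^ s) = of_nat n" using Cons by blast
    have "\<exists>n. gen c * of_nat ((p * q) ^ s) = of_nat n" if s: "s \<ge> q_exponent (Suc k) + Suc k" for s
    proof -
      let ?w = "if b then half k else half k + 1"
      have "(p * q) ^ s = (q ^ q_exponent (Suc k) * p ^ Suc k) * (q ^ (s - q_exponent (Suc k)) * p ^ (s - Suc k))"
      proof -
        have "p ^ s = p ^ Suc k * p ^ (s - Suc k)" "q ^ s = q ^ q_exponent (Suc k) * q ^ (s - q_exponent (Suc k))"
          using s by (simp_all only: power_add[symmetric]) simp_all
        then show ?thesis by (simp only: power_mult_distrib mult_ac)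
      qed
      then have "gen c * of_nat ((p * q) ^ s) =
          of_nat ?w / of_nat (q ^ q_exponent (Suc k) * p ^ Suc k) * (of_nat (q ^ q_exponent (Suc k) * p ^ Suc k) *
          of_nat (q ^ (s - q_exponent (Suc k)) * p ^ (s - Suc k)))"
        unfolding c gen.simps by (simp only: of_nat_mult)
      also have "\<dots> = of_nat (?w * (q ^ (s - q_exponent (Suc k)) * p ^ (s - Suc k)))"
        using p_gt_1 q_gt_2 by (simp del: q_exponent.simps)
      finally show ?thesis by blast
    qed
    then have "\<exists>n. val (c # xs) * of_nat ((p * q) ^ s) = of_nat n" if "s \<ge> max t (q_exponent (Suc k) + Suc k)" for s
      using that t[of s] by (metis distrib_right max.bounded_iff of_nat_add val_simps(2))
    then show ?case by blast
  qed (use of_nat_0 in auto)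
  ultimately show ?thesis by blast
qed

lemma comm_monoid_cancel_Mon: "comm_monoid_cancel Mon"
  by (intro comm_monoid_cancelI comm_monoidI)
    (auto simp only: Mon_simps add_ac range_val_add range_val_0 add_right_cancel add_0_left add_0_right)

lemma Units_Mon: "Units Mon = {0}"
proof -
  have "x = 0" if u: "x \<in> Units Mon" for x
  proof -
    obtain xs ys where "x = val xs" "val xs + val ys = 0"
      using u unfolding Units_def by auto
    then show ?thesis using val_nonneg[of xs] val_nonneg[of ys] by linarith
  qed
  moreover have "0 \<in> Units Mon" using range_val_0 unfolding Units_def by force
  ultimately show ?thesis by blast
qed

lemma atom_gen: "atom Mon (gen c)"
  unfolding atom_def Units_Mon
proof (intro conjI notI)
  have "gen c = val [c]" by simp
  then show "gen c \<in> carrier Mon" by (metis Mon_simps(1) rangeI)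
  show False if "gen c \<in> {0}" using gen_pos[of c] that by simp
  assume "\<exists>x\<in>carrier Mon - {0}. \<exists>y\<in>carrier Mon - {0}. gen c = x \<otimes>\<^bsub>Mon\<^esub> y"
  then obtain xs ys where xy: "val xs \<noteq> 0" "val ys \<noteq> 0" "gen c = val xs + val ys" by auto
  then have "xs @ ys = [c]" by (intro val_eq_genD) simp
  moreover have "xs \<noteq> []" "ys \<noteq> []" using xy val_eq_0_iff by blast+
  ultimately show False by (auto simp: append_eq_Cons_conv)
qed

lemma atomic_Mon: "atomic_monoid Mon"
  unfolding atomic_monoid_def
proof
  fix x assume "x \<in> carrier Mon"
  then obtain xs where x: "x = val xs" by auto
  show "atomic_element Mon x"
  proof (cases "xs = []")
    case True then show ?thesis by (simp add: atomic_element_def Units_Mon x)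
  next
    case False
    have mult: "(\<otimes>\<^bsub>Mon\<^esub>) = (+)" by (simp add: Mon_def)
    have "foldr (+) (map gen xs) 0 = x" by (simp add: x val_def sum_list.eq_foldr)
    then show ?thesis using False atom_gen unfolding atomic_element_def mult
      by (intro disjI2 exI[of _ "map gen xs"]) auto
  qed
qed

end

section \<open>Rank one\<close>

locale rat_valued_comm_group = comm_group A for A (structure) +
  fixes \<phi> :: "'a \<Rightarrow> rat"
  assumes hom: "x \<in> carrier A \<Longrightarrow> y \<in> carrier A \<Longrightarrow> \<phi> (x \<otimes> y) = \<phi> x + \<phi> y"
    and inj: "inj_on \<phi> (carrier A)"
begin

lemma hom_one: "\<phi> \<one> = 0"
  using hom[of \<one> \<one>] by simp

lemma eq_one_iff: "x \<in> carrier A \<Longrightarrow> x = \<one> \<longleftrightarrow> \<phi> x = 0"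
  using inj_on_eq_iff[OF inj, of x \<one>] hom_one by simp

lemma hom_pow: "x \<in> carrier A \<Longrightarrow> \<phi> (x [^] (n :: nat)) = of_nat n * \<phi> x"
  by (induction n) (simp_all add: hom hom_one algebra_simps)

lemma hom_inv: "x \<in> carrier A \<Longrightarrow> \<phi> (inv x) = - \<phi> x"
  using hom[of x "inv x"] hom_one by simp

lemma hom_int_pow:
  assumes x: "x \<in> carrier A"
  shows "\<phi> (x [^] (k :: int)) = of_int k * \<phi> x"
proof (cases k)
  case (nonneg n)
  then show ?thesis using hom_pow[OF x] by (simp add: int_pow_int)
next
  case (neg n)
  then have "x [^] k = inv (x [^] Suc n)" using int_pow_neg_int[OF x, of "Suc n"] by (simp only:)
  then have "\<phi> (x [^] k) = - (of_nat (Suc n) * \<phi> x)"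
    using hom_inv[of "x [^] Suc n"] hom_pow[OF x, of "Suc n"] x by (simp del: nat_pow_Suc)
  then show ?thesis unfolding neg(1) by (simp only: of_int_minus of_int_of_nat_eq mult_minus_left)
qed

lemma hom_finprod:
  "finite S \<Longrightarrow> (\<And>x. x \<in> S \<Longrightarrow> f x \<in> carrier A) \<Longrightarrow> \<phi> (finprod A f S) = (\<Sum>x\<in>S. \<phi> (f x))"
proof (induction S rule: finite_induct)
  case (insert x S)
  then have "f \<in> S \<rightarrow> carrier A" by auto
  then show ?case using insert by (simp add: hom)
qed (simp add: hom_one)

lemma torsion_free: "torsion_free_group A"
  unfolding torsion_free_group_def
proof (intro ballI allI impI)
  fix x and n :: nat
  assume x: "x \<in> carrier A" "0 < n" "x [^] n = \<one>"
  then have "of_nat n * \<phi> x = 0" using hom_pow hom_one by metis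
  then show "x = \<one>" using x eq_one_iff by simp
qed

lemma Z_independent_iff:
  "Z_independent A S \<longleftrightarrow> finite S \<and> S \<subseteq> carrier A \<and>
    (\<forall>k :: 'a \<Rightarrow> int. (\<Sum>x\<in>S. of_int (k x) * \<phi> x) = 0 \<longrightarrow> (\<forall>x\<in>S. k x = 0))"
proof -
  have "finprod A (\<lambda>x. x [^] k x) S = \<one> \<longleftrightarrow> (\<Sum>x\<in>S. of_int (k x) * \<phi> x) = 0"
    if "finite S" "S \<subseteq> carrier A" for k :: "'a \<Rightarrow> int"
  proof -
    have 1: "x [^] k x \<in> carrier A" if "x \<in> S" for x
      using \<open>S \<subseteq> carrier A\<close> that by (auto intro: int_pow_closed)
    then have "finprod A (\<lambda>x. x [^] k x) S \<in> carrier A" by (intro finprod_closed) auto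
    moreover have "\<phi> (finprod A (\<lambda>x. x [^] k x) S) = (\<Sum>x\<in>S. of_int (k x) * \<phi> x)"
      using hom_finprod[OF that(1), of "\<lambda>x. x [^] k x"] 1 that(2)
      by (simp add: hom_int_pow subsetD cong: sum.cong)
    ultimately show ?thesis using eq_one_iff by metis
  qed
  then show ?thesis unfolding Z_independent_def by blast
qed

text \<open>Any two rationals are linearly dependent over the integers.\<close>

lemma card_Z_independent_le:
  assumes "Z_independent A S"
  shows "card S \<le> 1"
proof (rule ccontr)
  assume "\<not> card S \<le> 1"
  have S: "finite S" "S \<subseteq> carrier A" using assms by (auto simp: Z_independent_def)
  then obtain x y where xy: "x \<in> S" "y \<in> S" "x \<noteq> y"
    using \<open>\<not> card S \<le> 1\<close> card_le_Suc0_iff_eq[OF S(1)] by auto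
  have "\<exists>k l :: int. (k \<noteq> 0 \<or> l \<noteq> 0) \<and> of_int k * \<phi> x + of_int l * \<phi> y = 0"
  proof (cases "\<phi> x = 0")
    case True then show ?thesis by (intro exI[of _ 1] exI[of _ 0]) simp
  next
    case False
    obtain a b c d where q: "quotient_of (\<phi> x) = (a, b)" "quotient_of (\<phi> y) = (c, d)"
      by (cases "quotient_of (\<phi> x)", cases "quotient_of (\<phi> y)")
    then have ab: "\<phi> x = of_int a / of_int b" "b > 0" and cd: "\<phi> y = of_int c / of_int d" "d > 0"
      by (auto intro: quotient_of_div quotient_of_denom_pos)
    \<comment> \<open>The coefficients come from cross-multiplying the two fractions.\<close>
    have "of_int (c * b) * \<phi> x + of_int (- (a * d)) * \<phi> y = 0"
      using ab cd by (simp add: field_simps)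
    moreover have "- (a * d) \<noteq> 0" using False ab cd by auto
    ultimately show ?thesis by blast
  qed
  then obtain k l :: int where kl: "k \<noteq> 0 \<or> l \<noteq> 0" "of_int k * \<phi> x + of_int l * \<phi> y = 0" by blast
  define c where "c z = (if z = x then k else if z = y then l else 0)" for z
  have "(\<Sum>z\<in>S. of_int (c z) * \<phi> z) = (\<Sum>z\<in>{x, y}. of_int (c z) * \<phi> z)"
    using S(1) xy by (intro sum.mono_neutral_right) (auto simp: c_def)
  also have "\<dots> = 0" using xy(3) kl(2) by (simp add: c_def)
  finally have "\<forall>z\<in>S. c z = 0" using assms by (simp add: Z_independent_iff)
  then have "c x = 0" "c y = 0" using xy by auto
  then show False using kl(1) xy(3) by (simp add: c_def)
qed

lemma group_rank_eq_1:
  assumes "x \<in> carrier A" "\<phi> x \<noteq> 0"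
  shows "group_rank A = 1"
  unfolding group_rank_def
proof (rule antisym)
  show "(SUP S\<in>Collect (Z_independent A). enat (card S)) \<le> 1"
    using card_Z_independent_le by (intro SUP_least) (auto simp: one_enat_def)
  have "Z_independent A {x}" using assms by (simp add: Z_independent_iff)
  then have "enat (card {x}) \<le> (SUP S\<in>Collect (Z_independent A). enat (card S))"
    by (intro SUP_upper) simp
  then show "1 \<le> (SUP S\<in>Collect (Z_independent A). enat (card S))"
    by (simp add: one_enat_def)
qed

end

text \<open>Formal differences embed into the rationals by \<open>a - b\<close>: the Grothendieck
  relation says that two differences are equal. The element \<open>c\<close> keeps the rank from
  being zero.\<close>

lemma rat_monoid_rank:
  fixes M :: "rat monoid"
  assumes M: "comm_monoid_cancel M" and add: "\<And>x y. x \<otimes>\<^bsub>M\<^esub> y = x + y"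
    and c: "c \<in> carrier M" "c \<noteq> 0"
  shows "monoid_rank M = 1" "torsion_free_monoid M"
proof -
  interpret M: comm_monoid_cancel M by (rule M)
  let ?K = "grothendieck_group M"
  let ?c = "\<lambda>a b. groth_rel M `` {(a, b)}"
  have one: "\<one>\<^bsub>M\<^esub> = 0" using M.l_one[OF c(1)] by (simp add: add)
  have eq: "?c a b = ?c a' b' \<longleftrightarrow> a - b = a' - b'"
    if "a \<in> carrier M" "b \<in> carrier M" "a' \<in> carrier M" "b' \<in> carrier M" for a b a' b'
    using that eq_equiv_class_iff[OF M.equiv_groth_rel, of "(a, b)" "(a', b')"]
    by (auto simp: groth_rel_def add algebra_simps)
  define \<phi> where "\<phi> X = (THE r. \<exists>a\<in>carrier M. \<exists>b\<in>carrier M. X = ?c a b \<and> r = a - b)" for X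
  have \<phi>: "\<phi> (?c a b) = a - b" if "a \<in> carrier M" "b \<in> carrier M" for a b
    unfolding \<phi>_def using that eq by (intro the_equality) auto
  interpret K: comm_group ?K by (rule M.comm_group_grothendieck_group)
  interpret rat_valued_comm_group ?K \<phi>
  proof
    fix X Y assume "X \<in> carrier ?K" "Y \<in> carrier ?K"
    then obtain a b a' b' where X: "a \<in> carrier M" "b \<in> carrier M" "X = ?c a b"
      and Y: "a' \<in> carrier M" "b' \<in> carrier M" "Y = ?c a' b'"
      by (elim M.grothendieck_group_cases)
    have "a + a' \<in> carrier M" "b + b' \<in> carrier M" using M.m_closed X Y by (simp_all add: add[symmetric])
    then show "\<phi> (X \<otimes>\<^bsub>?K\<^esub> Y) = \<phi> X + \<phi> Y"
      using X Y by (simp add: M.groth_mult_class add \<phi>)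
  next
    show "inj_on \<phi> (carrier ?K)"
    proof (rule inj_onI)
      fix X Y assume "X \<in> carrier ?K" "Y \<in> carrier ?K" and XY: "\<phi> X = \<phi> Y"
      then obtain a b a' b' where X: "a \<in> carrier M" "b \<in> carrier M" "X = ?c a b"
        and Y: "a' \<in> carrier M" "b' \<in> carrier M" "Y = ?c a' b'"
        by (elim M.grothendieck_group_cases)
      then show "X = Y" using XY by (simp add: \<phi> eq)
    qed
  qed
  have "?c c 0 \<in> carrier ?K" "\<phi> (?c c 0) \<noteq> 0"
    using c M.one_closed by (auto simp: one \<phi> intro: M.groth_class_closed)
  then show "monoid_rank M = 1" unfolding monoid_rank_def by (rule group_rank_eq_1)
  show "torsion_free_monoid M" unfolding torsion_free_monoid_def by (rule torsion_free)
qed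

section \<open>The monoid algebra\<close>

lemma prime_dvd_pow_add:
  assumes "Factorial_Ring.prime p"
  shows "[:int p:] dvd (a + b) ^ p - (a ^ p + b ^ p)"
proof -
  let ?f = "\<lambda>k. of_nat (p choose k) * a ^ k * b ^ (p - k)"
  have p0: "p > 0" using assms prime_gt_0_nat by blast
  have "(a + b) ^ p = (\<Sum>k\<le>p. ?f k)" by (rule binomial_ring)
  also have "{..p} = insert 0 (insert p {0<..<p})" using p0 by auto
  also have "(\<Sum>k\<in>\<dots>. ?f k) = b ^ p + (a ^ p + (\<Sum>k\<in>{0<..<p}. ?f k))"
    using p0 by simp
  finally have "(a + b) ^ p - (a ^ p + b ^ p) = (\<Sum>k\<in>{0<..<p}. ?f k)" by simp
  moreover have "[:int p:] dvd (\<Sum>k\<in>{0<..<p}. ?f k)"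
  proof (rule dvd_sum)
    fix k assume "k \<in> {0<..<p}"
    then have "p dvd p choose k" using assms by (intro dvd_choose_prime) auto
    then have "[:int p:] dvd of_nat (p choose k)"
      by (auto simp: of_nat_poly const_poly_dvd_iff coeff_pCons split: nat.splits)
    then show "[:int p:] dvd ?f k" by (intro dvd_mult2)
  qed
  ultimately show ?thesis by simp
qed

lemma prime_dvd_pow_diff:
  assumes p: "Factorial_Ring.prime p"
  shows "int p dvd c ^ p - c"
proof -
  have p_gt_1: "p > 1" using p by (rule prime_gt_1_nat)
  have "int p dvd int n ^ p - int n" for n
  proof (cases "p dvd n")
    case True
    then have "int p dvd int n" "int n dvd int n ^ p" using p_gt_1 by (auto intro: dvd_power)
    then show ?thesis by (intro dvd_diff) (auto intro: dvd_trans)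
  next
    case False
    then have "[n ^ (p - 1) = 1] (mod p)" by (rule fermat_theorem[OF p])
    then have "[n * n ^ (p - 1) = n * 1] (mod p)" by (rule cong_scalar_left)
    then have "[n ^ p = n] (mod p)" using p_gt_1 by (simp add: power_eq_if)
    then have "[int (n ^ p) = int n] (mod int p)" by (simp only: cong_int_iff)
    then show ?thesis by (simp add: cong_iff_dvd_diff)
  qed
  from this[of "nat (c mod int p)"] have "int p dvd (c mod int p) ^ p - c mod int p"
    using p_gt_1 by simp
  then have "((c mod int p) ^ p) mod int p = (c mod int p) mod int p" by (simp only: mod_eq_dvd_iff)
  then show ?thesis by (simp add: mod_eq_dvd_iff power_mod)
qed

text \<open>Induction on the coefficients: the \<open>p\<close>-th power is additive modulo
  \<open>p\<close> and, by Fermat, fixes constants.\<close>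

lemma frobenius_dvd:
  assumes p: "Factorial_Ring.prime p"
  shows "[:int p:] dvd (f \<circ>\<^sub>p [:0, 1:] ^ p) - f ^ p"
proof (induction f)
  case 0
  have "p > 0" using p prime_gt_0_nat by blast
  then show ?case by (simp add: zero_power)
next
  case (pCons a f)
  let ?X = "[:0, 1:] :: int poly"
  have pf: "pCons a f = [:a:] + ?X * f" by simp
  have 1: "[:int p:] dvd [:a:] - [:a:] ^ p"
    using prime_dvd_pow_diff[OF p, of a]
    by (auto simp: poly_const_pow const_poly_dvd_iff coeff_pCons dvd_diff_commute split: nat.splits)
  have 2: "[:int p:] dvd ?X ^ p * ((f \<circ>\<^sub>p ?X ^ p) - f ^ p)" using pCons by (intro dvd_mult)
  have 3: "[:int p:] dvd ([:a:] + ?X * f) ^ p - ([:a:] ^ p + (?X * f) ^ p)"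
    by (rule prime_dvd_pow_add[OF p])
  have "[:int p:] dvd ([:a:] - [:a:] ^ p) + ?X ^ p * ((f \<circ>\<^sub>p ?X ^ p) - f ^ p)
      - (([:a:] + ?X * f) ^ p - ([:a:] ^ p + (?X * f) ^ p))"
    by (rule dvd_diff[OF dvd_add[OF 1 2] 3])
  moreover have "\<dots> = (pCons a f \<circ>\<^sub>p ?X ^ p) - (pCons a f) ^ p"
    unfolding pf power_mult_distrib pcompose_add pcompose_mult pcompose_const
    by (simp only: pcompose_X_power[of 1, unfolded power_one_right]) (simp only: algebra_simps)
  ultimately show ?case by (simp only:)
qed

lemma coeff_pcompose_X_power:
  assumes "k > 0"
  shows "coeff (f \<circ>\<^sub>p [:0, 1 :: int:] ^ k) i = (if k dvd i then coeff f (i div k) else 0)"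
proof (induction f arbitrary: i)
  case (pCons a f)
  have X: "[:0, 1:] ^ k = monom (1 :: int) k" by (simp add: monom_altdef)
  have "coeff (pCons a f \<circ>\<^sub>p [:0, 1:] ^ k) i =
      coeff [:a:] i + (if i < k then 0 else coeff (f \<circ>\<^sub>p [:0, 1:] ^ k) (i - k))"
    by (simp add: pcompose_pCons X coeff_monom_mult)
  also have "\<dots> = (if k dvd i then coeff (pCons a f) (i div k) else 0)"
  proof (cases "i < k")
    case True
    then show ?thesis by (auto simp: coeff_pCons split: nat.splits)
  next
    case False
    then have "k dvd i \<longleftrightarrow> k dvd i - k" "i div k = Suc ((i - k) div k)"
      using assms by (auto simp: dvd_minus_self le_div_geq)
    then show ?thesis using False assms by (simp add: pCons.IH coeff_pCons split: nat.splits)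
  qed
  finally show ?case .
qed simp

section \<open>Elements of the algebra as polynomials in a root of the variable\<close>

context prime_pair
begin

abbreviation alg :: "(rat \<Rightarrow> int) ring"
  where "alg \<equiv> monoid_algebra (residue_ring (int p)) Mon"

definition pt :: "nat \<Rightarrow> nat \<Rightarrow> rat"
  where "pt t i = of_nat i / of_nat ((p * q) ^ t)"

text \<open>
  \<open>enc t P\<close> is \<open>P(x\<^bsup>1/(pq)\<^sup>t\<^esup>)\<close> with coefficients reduced modulo \<open>p\<close>; its exponents need not lie in \<open>Mon\<close>.
\<close>

definition enc :: "nat \<Rightarrow> int poly \<Rightarrow> rat \<Rightarrow> int"
  where "enc t P m = (if m \<in> range (pt t) then coeff P (inv_into UNIV (pt t) m) mod int p else 0)"

lemma base_pos: "(p * q) ^ t > 0" using p_gt_1 q_gt_2 by simp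

lemma inj_pt: "inj (pt t)"
  using p_gt_1 q_gt_2 by (auto simp: inj_def pt_def)

lemma pt_eq_iff [simp]: "pt t i = pt t j \<longleftrightarrow> i = j" using inj_pt by (auto dest: injD)

lemma pt_add: "pt t i + pt t j = pt t (i + j)" by (simp add: pt_def add_divide_distrib)

lemma enc_pt [simp]: "enc t P (pt t i) = coeff P i mod int p"
  by (simp add: enc_def inj_pt)

lemma enc_neq_0: "enc t P m \<noteq> 0 \<Longrightarrow> \<exists>i. m = pt t i \<and> \<not> int p dvd coeff P i"
  by (auto simp: enc_def inj_pt mod_eq_0_iff_dvd split: if_splits)

lemma enc_eq_iff: "enc t P = enc t Q \<longleftrightarrow> [:int p:] dvd P - Q"
proof
  assume "enc t P = enc t Q"
  then have "coeff P i mod int p = coeff Q i mod int p" for i using enc_pt by metis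
  then show "[:int p:] dvd P - Q" by (simp add: const_poly_dvd_iff mod_eq_dvd_iff)
next
  assume "[:int p:] dvd P - Q"
  then have "coeff P i mod int p = coeff Q i mod int p" for i
    by (simp add: const_poly_dvd_iff mod_eq_dvd_iff)
  then show "enc t P = enc t Q" by (auto simp: enc_def)
qed

lemma residues_p: "residues (int p)" using p_gt_1 by (simp add: residues_def)

lemma alg_carrier: "g \<in> carrier alg \<longleftrightarrow>
    (\<forall>m. g m \<in> {0..<int p}) \<and> {m. g m \<noteq> 0} \<subseteq> range val \<and> finite {m. g m \<noteq> 0}"
  by (auto simp: monoid_algebra_def residue_ring_def)

lemma alg_zero: "\<zero>\<^bsub>alg\<^esub> = (\<lambda>m. 0)" by (simp add: monoid_algebra_def residue_ring_def)

lemma alg_one: "\<one>\<^bsub>alg\<^esub> = enc t 1"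
proof -
  have z: "pt t 0 = 0" by (simp add: pt_def)
  have "enc t 1 m = (if m = 0 then 1 else 0)" for m
  proof (cases "m \<in> range (pt t)")
    case True
    then obtain i where i: "m = pt t i" by blast
    then have "m = 0 \<longleftrightarrow> i = 0" using pt_eq_iff[of t i 0] by (simp only: z)
    then show ?thesis unfolding i enc_pt using p_gt_1 by (cases i) simp_all
  next
    case False
    then have "m \<noteq> 0" using z by (metis rangeI)
    then show ?thesis using False by (simp add: enc_def)
  qed
  then show ?thesis by (auto simp: monoid_algebra_def residue_ring_def)
qed

lemma enc_zero_iff: "enc t P = \<zero>\<^bsub>alg\<^esub> \<longleftrightarrow> [:int p:] dvd P"
proof -
  have "\<zero>\<^bsub>alg\<^esub> = enc t 0" by (auto simp: alg_zero enc_def)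
  then show ?thesis using enc_eq_iff[of t P 0] by simp
qed

text \<open>As \<open>pt t\<close> is additive and injective, convolution over exponents becomes the
  Cauchy product of coefficients.\<close>

lemma enc_mult: "enc t P \<otimes>\<^bsub>alg\<^esub> enc t Q = enc t (P * Q)"
proof
  fix m
  interpret residues "int p" "residue_ring (int p)" by (rule residues_p) simp
  let ?S = "{(a, b). enc t P a \<noteq> 0 \<and> enc t Q b \<noteq> 0 \<and> a + b = m}"
  have fin: "finite {a. enc t P a \<noteq> 0}" for P
  proof (rule finite_subset)
    show "{a. enc t P a \<noteq> 0} \<subseteq> pt t ` {..degree P}"
      using enc_neq_0 by (fastforce intro: le_degree)
  qed simp
  have finS: "finite ?S"
    by (rule finite_subset[OF _ finite_cartesian_product[OF fin[of P] fin[of Q]]]) auto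
  have "(enc t P \<otimes>\<^bsub>alg\<^esub> enc t Q) m =
      finsum (residue_ring (int p)) (\<lambda>x. (case x of (a, b) \<Rightarrow> enc t P a * enc t Q b) mod int p) ?S"
    by (simp add: monoid_algebra_def residue_ring_def case_prod_unfold)
  also have "\<dots> = (\<Sum>(a, b)\<in>?S. enc t P a * enc t Q b) mod int p"
    using finS by (rule sum_cong)
  also have "\<dots> = enc t (P * Q) m"
  proof (cases "m \<in> range (pt t)")
    case False
    have "x \<notin> ?S" for x
    proof
      assume "x \<in> ?S"
      then obtain a b where ab: "enc t P a \<noteq> 0" "enc t Q b \<noteq> 0" "a + b = m" by auto
      then obtain i j where "a = pt t i" "b = pt t j" using enc_neq_0 by meson
      then have "m = pt t (i + j)" using ab(3) by (simp add: pt_add)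
      then show False using False by blast
    qed
    then have "?S = {}" by blast
    then show ?thesis using False by (simp only: sum.empty) (simp add: enc_def)
  next
    case True
    then obtain n where n: "m = pt t n" by blast
    let ?g = "\<lambda>i. (pt t i, pt t (n - i))"
    have inj: "inj_on ?g {..n}" by (auto intro: inj_onI)
    have sub: "?S \<subseteq> ?g ` {..n}"
    proof
      fix x assume "x \<in> ?S"
      then obtain a b where ab: "x = (a, b)" "enc t P a \<noteq> 0" "enc t Q b \<noteq> 0" "a + b = m" by auto
      then obtain i j where "a = pt t i" "b = pt t j" using enc_neq_0 by meson
      moreover from this have "i + j = n" using ab(4) n by (simp add: pt_add)
      ultimately show "x \<in> ?g ` {..n}" using ab(1) by (auto intro!: image_eqI[of _ _ i])
    qed
    \<comment> \<open>The pairs missing from \<open>?S\<close> have a coefficient divisible by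
      \<open>p\<close> and contribute zero.\<close>
    have "(\<Sum>(a, b)\<in>?S. enc t P a * enc t Q b) = (\<Sum>(a, b)\<in>?g ` {..n}. enc t P a * enc t Q b)"
      using sub by (intro sum.mono_neutral_left) (auto simp: n pt_add)
    also have "\<dots> = (\<Sum>i\<le>n. (coeff P i mod int p) * (coeff Q (n - i) mod int p))"
      by (subst sum.reindex[OF inj]) simp
    finally have sum: "(\<Sum>(a, b)\<in>?S. enc t P a * enc t Q b) =
      (\<Sum>i\<le>n. (coeff P i mod int p) * (coeff Q (n - i) mod int p))" .
    have "(\<Sum>(a, b)\<in>?S. enc t P a * enc t Q b) mod int p = coeff (P * Q) n mod int p"
      unfolding sum coeff_mult
      by (subst (1 2) mod_sum_eq[symmetric]) (simp only: mod_mult_eq)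
    then show ?thesis by (simp add: n)
  qed
  finally show "(enc t P \<otimes>\<^bsub>alg\<^esub> enc t Q) m = enc t (P * Q) m" .
qed

lemma enc_prod_list: "foldr (\<otimes>\<^bsub>mult_of alg\<^esub>) (map (enc t) Ps) \<one>\<^bsub>mult_of alg\<^esub> = enc t (prod_list Ps)"
  by (induction Ps) (simp_all add: enc_mult alg_one[of t])

text \<open>A step of size \<open>1 / (p * q) ^ t\<close> consists of \<open>p * q\<close> steps of
  the next level; this moves elements to finer levels.\<close>

lemma enc_refine: "enc (Suc t) (P \<circ>\<^sub>p [:0, 1:] ^ (p * q)) = enc t P"
proof
  fix m
  have pq: "p * q > 0" using p_gt_1 q_gt_2 by simp
  have pt: "pt t i = pt (Suc t) (i * (p * q))" for i using p_gt_1 q_gt_2 by (simp add: pt_def field_simps)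
  show "enc (Suc t) (P \<circ>\<^sub>p [:0, 1:] ^ (p * q)) m = enc t P m"
  proof (cases "m \<in> range (pt (Suc t))")
    case True
    then obtain i where i: "m = pt (Suc t) i" by blast
    show ?thesis
    proof (cases "p * q dvd i")
      case True
      then have "m = pt t (i div (p * q))" using i pt by simp
      then show ?thesis using i True by (metis coeff_pcompose_X_power[OF pq] enc_pt)
    next
      case False
      then have "m \<notin> range (pt t)" using i pt by (auto simp del: pt_eq_iff simp: pt_eq_iff)
      then show ?thesis using i False by (simp add: coeff_pcompose_X_power[OF pq]) (simp add: enc_def)
    qed
  next
    case False
    then have "m \<notin> range (pt t)" using pt by auto
    then show ?thesis using False by (simp add: enc_def)
  qed
qed

lemma alg_eq_enc:
  assumes "g \<in> carrier alg"
  obtains t where "\<And>s. s \<ge> t \<Longrightarrow> \<exists>P. g = enc s P"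
proof -
  let ?S = "{m. g m \<noteq> 0}"
  have g: "\<And>m. g m \<in> {0..<int p}" "?S \<subseteq> range val" "finite ?S"
    using assms alg_carrier by blast+
  have "\<forall>m\<in>?S. \<exists>t. \<forall>s\<ge>t. m \<in> range (pt s)"
  proof
    fix m assume "m \<in> ?S"
    then have "m \<in> range val" using g(2) by (rule rev_subsetD)
    from range_val_denominator[OF this]
    obtain t where t: "\<And>s. s \<ge> t \<Longrightarrow> \<exists>n. m * of_nat ((p * q) ^ s) = of_nat n" by blast
    have "m \<in> range (pt s)" if "s \<ge> t" for s
    proof -
      obtain n where "m * of_nat ((p * q) ^ s) = of_nat n" using t \<open>s \<ge> t\<close> by blast
      then have "m = pt s n" using base_pos[of s] by (simp add: pt_def eq_divide_eq)
      then show ?thesis by blast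
    qed
    then show "\<exists>t. \<forall>s\<ge>t. m \<in> range (pt s)" by blast
  qed
  then obtain T where T: "\<And>m s. m \<in> ?S \<Longrightarrow> s \<ge> T m \<Longrightarrow> m \<in> range (pt s)" by metis
  \<comment> \<open>The \<open>0\<close> covers the zero element, whose support is empty.\<close>
  have "\<exists>P. g = enc s P" if s: "s \<ge> Max (insert 0 (T ` ?S))" for s
  proof -
    have S: "m \<in> range (pt s)" if "m \<in> ?S" for m
      using T[OF that] s g(3) that by (simp add: Max_ge_iff)
    define P where "P = (\<Sum>m\<in>?S. monom (g m) (inv_into UNIV (pt s) m))"
    have c: "coeff P i = g (pt s i)" for i
    proof -
      have "coeff P i = (\<Sum>m\<in>?S. if m = pt s i then g m else 0)"
        unfolding P_def coeff_sum coeff_monom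
      proof (rule sum.cong)
        fix m assume "m \<in> ?S"
        then obtain j where "m = pt s j" using S by blast
        then show "(if inv_into UNIV (pt s) m = i then g m else 0) = (if m = pt s i then g m else 0)"
          by (simp add: inj_pt)
      qed simp
      then show ?thesis using g(3) by simp
    qed
    have "g m = enc s P m" for m
    proof (cases "m \<in> range (pt s)")
      case True
      then obtain i where "m = pt s i" by blast
      then show ?thesis using g(1)[of m] by (simp add: c)
    next
      case False
      then have "g m = 0" using S by blast
      then show ?thesis using False by (simp add: enc_def)
    qed
    then show ?thesis by blast
  qed
  then show ?thesis using that by blast
qed

definition supp_ok :: "nat \<Rightarrow> int poly \<Rightarrow> bool"
  where "supp_ok t P \<longleftrightarrow> (\<forall>i. \<not> int p dvd coeff P i \<longrightarrow> pt t i \<in> range val)"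

lemma enc_carrier_iff: "enc t P \<in> carrier alg \<longleftrightarrow> supp_ok t P"
proof -
  have "finite {m. enc t P m \<noteq> 0}"
  proof (rule finite_subset)
    show "{a. enc t P a \<noteq> 0} \<subseteq> pt t ` {..degree P}"
      using enc_neq_0 by (fastforce intro: le_degree)
  qed simp
  moreover have "enc t P m \<in> {0..<int p}" for m using p_gt_1 by (simp add: enc_def)
  moreover have "{m. enc t P m \<noteq> 0} = {pt t i |i. \<not> int p dvd coeff P i}"
    using enc_neq_0 by (auto simp: mod_eq_0_iff_dvd)
  ultimately show ?thesis unfolding alg_carrier supp_ok_def by auto
qed

lemma supp_ok_mult:
  assumes "supp_ok t P" "supp_ok t Q"
  shows "supp_ok t (P * Q)"
  unfolding supp_ok_def
proof (intro allI impI)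
  fix n assume "\<not> int p dvd coeff (P * Q) n"
  then obtain i where i: "i \<le> n" "\<not> int p dvd coeff P i * coeff Q (n - i)"
    unfolding coeff_mult by (meson atMost_iff dvd_sum)
  then have "pt t i + pt t (n - i) \<in> range val"
    using assms unfolding supp_ok_def by (metis dvd_mult dvd_mult2 range_val_add)
  then show "pt t n \<in> range val" using i(1) by (simp add: pt_add)
qed

lemma supp_ok_power: "supp_ok t P \<Longrightarrow> supp_ok t (P ^ n)"
proof (induction n)
  case 0
  have "pt t 0 = 0" by (simp add: pt_def)
  then show ?case using range_val_0 by (auto simp: supp_ok_def)
qed (simp add: supp_ok_mult)

text \<open>The constant term of \<open>H\<close> is invertible modulo \<open>p\<close>. So a
  nonzero coefficient of \<open>G\<close> at \<open>j\<close> requires a nonzero one of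
  \<open>P\<close> at \<open>j\<close>, or a nonzero product of coefficients of \<open>H\<close> at
  \<open>i > 0\<close> and of \<open>G\<close> at \<open>j - i\<close>. In both cases
  \<open>pt t j\<close> lies in the monoid, the second by induction.\<close>

lemma supp_ok_factor:
  assumes H: "supp_ok t H" "\<not> int p dvd coeff H 0" and P: "supp_ok t P" "[:int p:] dvd P - H * G"
  shows "supp_ok t G"
proof -
  have "\<not> int p dvd coeff G j \<longrightarrow> pt t j \<in> range val" for j
  proof (induction j rule: less_induct)
    case (less j)
    show ?case
    proof
      assume j: "\<not> int p dvd coeff G j"
      show "pt t j \<in> range val"
      proof (cases "\<exists>i\<in>{0<..j}. \<not> int p dvd coeff H i * coeff G (j - i)")
        case True
        then obtain i where i: "0 < i" "i \<le> j" "\<not> int p dvd coeff H i * coeff G (j - i)" by auto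
        then have "pt t i \<in> range val" "pt t (j - i) \<in> range val"
          using H(1) less[of "j - i"] unfolding supp_ok_def by (auto intro: dvd_mult dvd_mult2)
        then have "pt t i + pt t (j - i) \<in> range val" by (rule range_val_add)
        then show ?thesis using i by (simp add: pt_add)
      next
        case False
        have "{..j} = insert 0 {0<..j}" by auto
        then have "coeff (H * G) j = coeff H 0 * coeff G j + (\<Sum>i\<in>{0<..j}. coeff H i * coeff G (j - i))"
          by (simp add: coeff_mult)
        moreover have "int p dvd (\<Sum>i\<in>{0<..j}. coeff H i * coeff G (j - i))"
          using False by (intro dvd_sum) blast
        moreover have "\<not> int p dvd coeff H 0 * coeff G j"
          using H(2) j p by (simp add: prime_dvd_mult_iff)
        moreover have "int p dvd coeff P j - coeff (H * G) j"
          using P(2) by (simp add: const_poly_dvd_iff)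
        ultimately have "\<not> int p dvd coeff P j"
          by (metis dvd_add_left_iff dvd_diff_commute diff_add_cancel)
        then show ?thesis using P(1) by (simp add: supp_ok_def)
      qed
    qed
  qed
  then show ?thesis by (simp add: supp_ok_def)
qed

end

section \<open>Multiples of \<open>f\<close> in the algebra\<close>

locale persistent_prime = prime_pair +
  fixes f :: "int poly"
  assumes f: "lead_coeff f = 1" "degree f > 0" "\<not> int p dvd coeff f 0"
    "\<And>m. prime_mod p (f \<circ>\<^sub>p [:0, 1:] ^ (q ^ m))"
begin

text \<open>
  Through \<open>enc t\<close>, the polynomial \<open>F t\<close> stands for \<open>f(x\<^bsup>1/p\<^sup>t\<^esup>)\<close>.
\<close>

definition F :: "nat \<Rightarrow> int poly" where "F t = f \<circ>\<^sub>p [:0, 1:] ^ (q ^ t)"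

lemma prime_F: "prime_mod p (F t)" using f(4) by (simp add: F_def)

lemma coeff_F: "coeff (F t) i = (if q ^ t dvd i then coeff f (i div q ^ t) else 0)"
  unfolding F_def using q_gt_2 by (intro coeff_pcompose_X_power) simp

text \<open>The factor \<open>q\<close> of the exponent turns \<open>F t\<close> into
  \<open>F (Suc t)\<close>; the factor \<open>p\<close> yields a \<open>p\<close>-th power by
  Frobenius.\<close>

lemma F_refine: "[:int p:] dvd (F t \<circ>\<^sub>p [:0, 1:] ^ (p * q)) - F (Suc t) ^ p"
proof -
  have "F t \<circ>\<^sub>p [:0, 1:] ^ (p * q) = F (Suc t) \<circ>\<^sub>p [:0, 1:] ^ p"
    unfolding F_def pcompose_assoc[symmetric] pcompose_power pcompose_X_power
    by (simp add: pcompose_pCons power_mult[symmetric] mult_ac)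
  then show ?thesis using frobenius_dvd[OF p] by simp
qed

lemma supp_ok_F: "supp_ok t (F t)"
  unfolding supp_ok_def coeff_F
proof (intro allI impI)
  fix i assume "\<not> int p dvd (if q ^ t dvd i then coeff f (i div q ^ t) else 0)"
  then obtain j where "i = q ^ t * j" by (auto split: if_splits)
  \<comment> \<open>All exponents are multiples of \<open>1 / p ^ t\<close>, because
    \<open>q ^ t\<close> cancels.\<close>
  then have "pt t i = of_nat j * (1 / of_nat (p ^ t))"
    using q_gt_2 by (simp add: pt_def power_mult_distrib)
  then show "pt t i \<in> range val" using range_val_mult inverse_power_in_range_val by metis
qed

lemma F_ideal_lift:
  assumes "P \<in> mod_ideal p (F t)"
  shows "P \<circ>\<^sub>p [:0, 1:] ^ (p * q) \<in> mod_ideal p (F (Suc t))"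
proof (rule mod_ideal_trans[OF mod_ideal_pcompose[OF assms]])
  have "F (Suc t) ^ p = F (Suc t) * F (Suc t) ^ (p - 1)" using p_gt_1 by (simp add: power_eq_if)
  then show "F t \<circ>\<^sub>p [:0, 1:] ^ (p * q) \<in> mod_ideal p (F (Suc t))"
    using F_refine[of t] by (intro mod_idealI[of _ _ _ "F (Suc t) ^ (p - 1)"]) simp
qed

lemma F_ideal_lift_ge:
  assumes "t \<le> s" "P \<in> mod_ideal p (F t)"
  shows "\<exists>P'. enc t P = enc s P' \<and> P' \<in> mod_ideal p (F s)"
  using assms
proof (induction s rule: dec_induct)
  case (step s)
  then show ?case using enc_refine F_ideal_lift by metis
qed blast

text \<open>At a level fine enough for a supposed inverse, \<open>1\<close> would be a multiple of
  the prime \<open>F s\<close> modulo \<open>p\<close>.\<close>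

lemma F_ideal_not_unit:
  assumes P: "P \<in> mod_ideal p (F t)"
  shows "enc t P \<notin> Units (mult_of alg)"
proof
  assume "enc t P \<in> Units (mult_of alg)"
  then obtain x where x: "x \<in> carrier alg" "x \<otimes>\<^bsub>alg\<^esub> enc t P = \<one>\<^bsub>alg\<^esub>"
    by (auto simp: Units_def)
  obtain t' where t': "\<And>s. s \<ge> t' \<Longrightarrow> \<exists>Q. x = enc s Q" using alg_eq_enc[OF x(1)] by blast
  define s where "s = max t t'"
  obtain Q where Q: "x = enc s Q" using t'[of s] by (auto simp: s_def)
  obtain P' where P': "enc t P = enc s P'" "P' \<in> mod_ideal p (F s)"
    using F_ideal_lift_ge[OF _ P, of s] by (auto simp: s_def)
  have "enc s (Q * P') = enc s 1" using x(2) by (simp add: Q P'(1) enc_mult alg_one[of s])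
  then have "[:int p:] dvd Q * P' - 1" by (simp only: enc_eq_iff)
  then have "1 \<in> mod_ideal p (F s)"
    using mod_ideal_cong[OF mod_ideal_const] mod_ideal_mult[OF P'(2)] by blast
  then show False using prime_F by (simp add: prime_mod_def)
qed

text \<open>One level further, \<open>F t\<close> becomes the \<open>p\<close>-th power of
  \<open>F (Suc t)\<close>. Splitting off one factor leaves a cofactor that is still a multiple of
  \<open>F (Suc t)\<close>, as \<open>p \<ge> 2\<close>, so neither part is a unit.\<close>

lemma F_ideal_not_atom:
  assumes P: "P \<in> mod_ideal p (F t)" and g: "enc t P \<in> carrier (mult_of alg)"
  shows "\<not> atom (mult_of alg) (enc t P)"
proof -
  obtain G where G: "[:int p:] dvd P - F t * G" using P by (elim mod_idealE)
  have "supp_ok t P" using g by (simp add: enc_carrier_iff)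
  moreover have "\<not> int p dvd coeff (F t) 0" using f(3) by (simp add: coeff_F)
  \<comment> \<open>The constant term of \<open>F t\<close> keeps the exponents of the cofactor in
    the monoid, so that the splitting takes place inside the algebra.\<close>
  ultimately have "supp_ok t G" using supp_ok_factor[OF supp_ok_F] G by blast
  define G' where "G' = G \<circ>\<^sub>p [:0, 1:] ^ (p * q)"
  define K where "K = F (Suc t) ^ (p - 1) * G'"
  have "supp_ok (Suc t) G'"
    using \<open>supp_ok t G\<close> unfolding enc_carrier_iff[symmetric] G'_def enc_refine .
  then have "supp_ok (Suc t) K" unfolding K_def by (intro supp_ok_mult supp_ok_power supp_ok_F)
  have FK: "F (Suc t) * K = F (Suc t) ^ p * G'" using p_gt_1 by (simp add: K_def power_eq_if)
  have "[:int p:] dvd (P \<circ>\<^sub>p [:0, 1:] ^ (p * q)) - (F t \<circ>\<^sub>p [:0, 1:] ^ (p * q)) * G'"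
    using pcompose_dvd[OF G] by (simp add: G'_def pcompose_diff pcompose_mult)
  moreover have "[:int p:] dvd ((F t \<circ>\<^sub>p [:0, 1:] ^ (p * q)) - F (Suc t) ^ p) * G'"
    using F_refine by (rule dvd_mult2)
  ultimately have "[:int p:] dvd ((P \<circ>\<^sub>p [:0, 1:] ^ (p * q)) - (F t \<circ>\<^sub>p [:0, 1:] ^ (p * q)) * G')
      + ((F t \<circ>\<^sub>p [:0, 1:] ^ (p * q)) - F (Suc t) ^ p) * G'" by (rule dvd_add)
  then have "[:int p:] dvd (P \<circ>\<^sub>p [:0, 1:] ^ (p * q)) - F (Suc t) * K"
    unfolding FK by (simp add: algebra_simps)
  then have eq: "enc t P = enc (Suc t) (F (Suc t)) \<otimes>\<^bsub>alg\<^esub> enc (Suc t) K"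
    unfolding enc_mult enc_refine[of t P, symmetric] by (simp only: enc_eq_iff)
  have nz: "\<not> [:int p:] dvd F (Suc t) * K"
    using g eq by (simp add: enc_mult enc_zero_iff)
  have "enc (Suc t) (F (Suc t)) \<in> carrier (mult_of alg)" "enc (Suc t) K \<in> carrier (mult_of alg)"
    using nz supp_ok_F \<open>supp_ok (Suc t) K\<close> by (auto simp: enc_carrier_iff enc_zero_iff)
  moreover have "enc (Suc t) (F (Suc t)) \<notin> Units (mult_of alg)"
    by (rule F_ideal_not_unit) simp
  moreover have "enc (Suc t) K \<notin> Units (mult_of alg)"
  proof (rule F_ideal_not_unit)
    have "p - 1 = Suc (p - 2)" using p_gt_1 by simp
    then have "K = F (Suc t) * (F (Suc t) ^ (p - 2) * G')" by (simp add: K_def mult.assoc)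
    then show "K \<in> mod_ideal p (F (Suc t))" by simp
  qed
  ultimately show ?thesis unfolding atom_def using eq by auto
qed

lemma alg_list_eq_enc:
  assumes "set gs \<subseteq> carrier alg"
  obtains t where "\<And>s. s \<ge> t \<Longrightarrow> \<exists>Ps. gs = map (enc s) Ps"
  using assms
proof (induction gs arbitrary: thesis)
  case Nil then show ?case by simp
next
  case (Cons g gs)
  obtain t where t: "\<And>s. s \<ge> t \<Longrightarrow> \<exists>Ps. gs = map (enc s) Ps" using Cons by auto
  obtain t' where t': "\<And>s. s \<ge> t' \<Longrightarrow> \<exists>P. g = enc s P" using alg_eq_enc Cons.prems(2) by auto
  have "\<exists>Ps. g # gs = map (enc s) Ps" if "s \<ge> max t t'" for s
    using t[of s] t'[of s] that by (metis list.simps(9) max.bounded_iff)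
  then show ?case using Cons.prems(1) by blast
qed

lemma not_quasi_atomic: "\<not> quasi_atomic_domain alg"
proof
  assume qa: "quasi_atomic_domain alg"
  \<comment> \<open>The element without an atomic multiple is \<open>f\<close> itself, at level
    \<open>0\<close>.\<close>
  have F0: "enc 0 (F 0) \<in> carrier (mult_of alg)"
  proof -
    have "\<not> [:int p:] dvd F 0" using f(3) by (auto simp: const_poly_dvd_iff coeff_F intro!: exI[of _ 0])
    then show ?thesis using supp_ok_F by (simp add: enc_carrier_iff enc_zero_iff)
  qed
  obtain a where a: "a \<in> carrier (mult_of alg)" "atomic_element (mult_of alg) (a \<otimes>\<^bsub>alg\<^esub> enc 0 (F 0))"
    using qa F0 unfolding quasi_atomic_domain_def quasi_atomic_monoid_def by auto
  obtain t where t: "\<And>s. s \<ge> t \<Longrightarrow> \<exists>P. a = enc s P" using alg_eq_enc a(1) by auto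
  have rep: "\<exists>P \<in> mod_ideal p (F s). a \<otimes>\<^bsub>alg\<^esub> enc 0 (F 0) = enc s P" if s: "s \<ge> t" for s
  proof -
    obtain B where "enc 0 (F 0) = enc s B" "B \<in> mod_ideal p (F s)"
      using F_ideal_lift_ge[of 0 s "F 0"] by auto
    moreover obtain A where "a = enc s A" using t s by blast
    ultimately show ?thesis using mod_ideal_mult[of B p "F s" A] by (auto simp: enc_mult)
  qed
  have "a \<otimes>\<^bsub>alg\<^esub> enc 0 (F 0) \<notin> Units (mult_of alg)"
    using rep[OF order_refl] F_ideal_not_unit by auto
  then obtain gs where gs: "\<And>g. g \<in> set gs \<Longrightarrow> atom (mult_of alg) g"
      "foldr (\<otimes>\<^bsub>mult_of alg\<^esub>) gs \<one>\<^bsub>mult_of alg\<^esub> = a \<otimes>\<^bsub>alg\<^esub> enc 0 (F 0)"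
    using a(2) unfolding atomic_element_def by blast
  have "set gs \<subseteq> carrier alg" using gs(1) by (auto simp: atom_def)
  then obtain t' where t': "\<And>s. s \<ge> t' \<Longrightarrow> \<exists>Ps. gs = map (enc s) Ps" using alg_list_eq_enc by blast
  \<comment> \<open>At this common level the atoms and their product are all polynomials; the prime
    \<open>F s\<close> divides the product, hence one of the atoms.\<close>
  define s where "s = max t t'"
  obtain Ps where Ps: "gs = map (enc s) Ps" using t'[of s] by (auto simp: s_def)
  obtain P where P: "P \<in> mod_ideal p (F s)" "a \<otimes>\<^bsub>alg\<^esub> enc 0 (F 0) = enc s P"
    using rep[of s] by (auto simp: s_def)
  have "enc s (prod_list Ps) = enc s P" using gs(2) P(2) Ps enc_prod_list by metis
  then have "[:int p:] dvd prod_list Ps - P" by (simp only: enc_eq_iff)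
  then have "prod_list Ps \<in> mod_ideal p (F s)"
    using mod_ideal_cong[OF mod_ideal_const] P(1) by blast
  then obtain Q where Q: "Q \<in> set Ps" "Q \<in> mod_ideal p (F s)"
    using prime_mod_prod_listD[OF prime_F] by blast
  then have "atom (mult_of alg) (enc s Q)" using gs(1) Ps by auto
  moreover from this have "enc s Q \<in> carrier (mult_of alg)" by (simp add: atom_def)
  ultimately show False using F_ideal_not_atom[OF Q(2)] by blast
qed

end

theorem theorem5p6:
  fixes p :: nat
  assumes "Factorial_Ring.prime p"
  shows "\<exists>M :: rat monoid.
    comm_monoid_cancel M \<and> monoid_rank M = 1 \<and> torsion_free_monoid M \<and> atomic_monoid M \<and>
    \<not> quasi_atomic_domain (monoid_algebra (residue_ring (int p)) M)"
proof -
  \<comment> \<open>Any odd prime other than \<open>p\<close> serves.\<close>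
  define q :: nat where "q = (if p = 3 then 5 else 3)"
  have "Factorial_Ring.prime q" "odd q" "q \<noteq> p"
    by (auto simp: q_def)
  then interpret prime_pair p q using assms by unfold_locales
  obtain f where "lead_coeff f = 1" "degree f > 0" "\<not> int p dvd coeff f 0"
      "\<And>m. prime_mod p (f \<circ>\<^sub>p [:0, 1:] ^ (q ^ m))"
    using ex_persistent_prime_poly[OF p q] by blast
  then interpret persistent_prime p q f by unfold_locales
  have "gen (True, 0) \<in> carrier Mon" "gen (True, 0) \<noteq> 0"
    using atom_gen[of "(True, 0)"] gen_pos[of "(True, 0)"] unfolding atom_def by (blast, metis less_irrefl)
  then have "monoid_rank Mon = 1" "torsion_free_monoid Mon"
    using rat_monoid_rank[OF comm_monoid_cancel_Mon Mon_simps(2)] by blast+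
  then show ?thesis
    using comm_monoid_cancel_Mon atomic_Mon not_quasi_atomic by blast
qed

end
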